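(* For every integer $k\ge4$, $\mathcal{H}_k\subsetneq\mathcal{O}_k$, i.e. $\mathcal{H}_k$ is a proper subset of $\mathcal{O}_k$.
   Context: $\mathbb{C}^k$ is regarded as a commutative unital algebra under coordinatewise multiplication with unit $e=(1,\dots,1)$. A Banach algebra norm on $\mathbb{C}^k$ is a norm with $\|v\cdot w\|\le\|v\|\,\|w\|$ for all $v,w$ and $\|e\|=1$. The ball of a norm is its closed unit ball $\{v\in\mathbb{C}^k:\|v\|\le1\}$. $\mathcal{O}_k$ is the set of all balls of Banach algebra norms on $\mathbb{C}^k$ such that the resulting Banach algebra has a unital isometric representation as an algebra of operators on a Hilbert space. $\mathcal{H}_k$ is the set of all balls of Banach algebra norms on $\mathbb{C}^k$ satisfying the multi-variable von Neumann inequality: for every $n$, all $a_1,\dots,a_n$ in the closed unit ball and every polynomial $p$ in $n$ variables, $\|p(a_1,\dots,a_n)\|\le\sup\{|p(z_1,\dots,z_n)|:|z_i|\le1,\ 1\le i\le n\}$. *)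

theory Defs
  imports
    "HOL-Analysis.Analysis"
    "HOL-Library.Poly_Mapping"
    "HOL-Library.Equipollence"
    "HOL-Algebra.Module"
begin

section \<open>Banach algebra norms\<close>

text \<open>
  The algebra \<open>\<complex>\<^sup>k\<close> is \<^typ>\<open>complex ^ 'k\<close>, whose library multiplication is coordinatewise with
  unit \<^term>\<open>1 :: complex ^ 'k\<close>. Its library norm (the Euclidean one) plays no role here.
\<close>

definition banach_algebra_norm :: "(complex ^ 'k \<Rightarrow> real) \<Rightarrow> bool" where
  "banach_algebra_norm N \<longleftrightarrow>
     (\<forall>v. 0 \<le> N v) \<and>
     (\<forall>v. N v = 0 \<longleftrightarrow> v = 0) \<and>
     (\<forall>c v. N (c *s v) = cmod c * N v) \<and>
     (\<forall>v w. N (v + w) \<le> N v + N w) \<and>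
     (\<forall>v w. N (v * w) \<le> N v * N w) \<and>
     N 1 = 1"

definition norm_ball :: "(complex ^ 'k \<Rightarrow> real) \<Rightarrow> (complex ^ 'k) set" where
  "norm_ball N = {v. N v \<le> 1}"


section \<open>Complex Hilbert spaces\<close>

text \<open>
  Hilbert spaces are carrier-based, so that one can quantify over all of them within a type.
\<close>

definition complex_field :: "complex ring" where
  "complex_field = \<lparr>carrier = UNIV, monoid.mult = (*), one = 1, ring.zero = 0, add = (+)\<rparr>"

locale complex_inner_product_space = module complex_field H
  for H :: "(complex, 'h) module" (structure) +
  fixes ip :: "'h \<Rightarrow> 'h \<Rightarrow> complex"
  assumes ip_add: "\<lbrakk>x \<in> carrier H; y \<in> carrier H; z \<in> carrier H\<rbrakk>
      \<Longrightarrow> ip (x \<oplus>\<^bsub>H\<^esub> y) z = ip x z + ip y z"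
    and ip_smult: "\<lbrakk>x \<in> carrier H; y \<in> carrier H\<rbrakk> \<Longrightarrow> ip (c \<odot>\<^bsub>H\<^esub> x) y = c * ip x y"
    and ip_commute: "\<lbrakk>x \<in> carrier H; y \<in> carrier H\<rbrakk> \<Longrightarrow> ip x y = cnj (ip y x)"
    and ip_nonneg: "x \<in> carrier H \<Longrightarrow> 0 \<le> Re (ip x x)"
    and ip_definite: "\<lbrakk>x \<in> carrier H; ip x x = 0\<rbrakk> \<Longrightarrow> x = \<zero>\<^bsub>H\<^esub>"

definition ip_norm :: "('h \<Rightarrow> 'h \<Rightarrow> complex) \<Rightarrow> 'h \<Rightarrow> real" where
  "ip_norm ip x = sqrt (Re (ip x x))"

locale complex_hilbert_space = complex_inner_product_space +
  assumes complete: "Metric_space.mcomplete (carrier H) (\<lambda>x y. ip_norm ip (x \<ominus>\<^bsub>H\<^esub> y))"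

definition bounded_operator ::
    "(complex, 'h) module \<Rightarrow> ('h \<Rightarrow> 'h \<Rightarrow> complex) \<Rightarrow> ('h \<Rightarrow> 'h) \<Rightarrow> bool" where
  "bounded_operator H ip T \<longleftrightarrow>
     (\<forall>x\<in>carrier H. T x \<in> carrier H) \<and>
     (\<forall>x\<in>carrier H. \<forall>y\<in>carrier H. T (x \<oplus>\<^bsub>H\<^esub> y) = T x \<oplus>\<^bsub>H\<^esub> T y) \<and>
     (\<forall>c. \<forall>x\<in>carrier H. T (c \<odot>\<^bsub>H\<^esub> x) = c \<odot>\<^bsub>H\<^esub> T x) \<and>
     (\<exists>B. \<forall>x\<in>carrier H. ip_norm ip (T x) \<le> B * ip_norm ip x)"

definition operator_norm ::
    "(complex, 'h) module \<Rightarrow> ('h \<Rightarrow> 'h \<Rightarrow> complex) \<Rightarrow> ('h \<Rightarrow> 'h) \<Rightarrow> real" where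
  "operator_norm H ip T = (SUP x\<in>{x \<in> carrier H. ip_norm ip x \<le> 1}. ip_norm ip (T x))"

definition unital_representation ::
    "(complex, 'h) module \<Rightarrow> ('h \<Rightarrow> 'h \<Rightarrow> complex) \<Rightarrow> (complex ^ 'k \<Rightarrow> 'h \<Rightarrow> 'h) \<Rightarrow> bool" where
  "unital_representation H ip \<pi> \<longleftrightarrow>
     (\<forall>v. bounded_operator H ip (\<pi> v)) \<and>
     (\<forall>x\<in>carrier H. \<pi> 1 x = x) \<and>
     (\<forall>v w. \<forall>x\<in>carrier H. \<pi> (v + w) x = \<pi> v x \<oplus>\<^bsub>H\<^esub> \<pi> w x) \<and>
     (\<forall>c v. \<forall>x\<in>carrier H. \<pi> (c *s v) x = c \<odot>\<^bsub>H\<^esub> \<pi> v x) \<and>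
     (\<forall>v w. \<forall>x\<in>carrier H. \<pi> (v * w) x = \<pi> v (\<pi> w x))"


section \<open>The set \<open>\<O>\<^sub>k\<close>\<close>

text \<open>
  HOL cannot quantify over types inside a formula, so the Hilbert spaces range over all those whose
  underlying set is contained in the type \<^typ>\<open>'h\<close>, which is an explicit argument. If \<^typ>\<open>'h\<close> has fewer than continuum many
  elements, it carries no nonzero Hilbert space and the set is empty.
\<close>

definition operator_algebra_balls :: "'h itself \<Rightarrow> (complex ^ 'k) set set" where
  "operator_algebra_balls (_ :: 'h itself) =
     {norm_ball N | N. banach_algebra_norm N \<and>
        (\<exists>(H :: (complex, 'h) module) ip \<pi>.
           complex_hilbert_space H ip \<and> unital_representation H ip \<pi> \<and>
           (\<forall>v. operator_norm H ip (\<pi> v) = N v))}"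


section \<open>The set \<open>\<H>\<^sub>k\<close>\<close>

text \<open>
  A monomial is a finitely supported exponent function, and a polynomial a finitely supported
  assignment of coefficients to monomials. The variables are indexed by \<open>0, \<dots>, n - 1\<close>.
\<close>

type_synonym cpoly = "(nat \<Rightarrow>\<^sub>0 nat) \<Rightarrow>\<^sub>0 complex"

definition in_variables :: "nat \<Rightarrow> cpoly \<Rightarrow> bool" where
  "in_variables n p \<longleftrightarrow> (\<forall>m\<in>Poly_Mapping.keys p. Poly_Mapping.keys m \<subseteq> {..<n})"

text \<open>
  Evaluation in a commutative \<open>\<complex>\<close>-algebra with structure map \<open>\<phi>\<close>: this is the identity for
  \<open>\<complex>\<close> itself, and \<^term>\<open>vec\<close>, i.e. \<open>c \<mapsto> c e\<close>, for \<open>\<complex>\<^sup>k\<close>.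
\<close>

definition eval_poly :: "(complex \<Rightarrow> 'a) \<Rightarrow> (nat \<Rightarrow> 'a) \<Rightarrow> cpoly \<Rightarrow> 'a::comm_ring_1" where
  "eval_poly \<phi> a p = (\<Sum>m\<in>Poly_Mapping.keys p.
     \<phi> (Poly_Mapping.lookup p m) * (\<Prod>i\<in>Poly_Mapping.keys m. a i ^ Poly_Mapping.lookup m i))"

definition polydisc_sup :: "nat \<Rightarrow> cpoly \<Rightarrow> real" where
  "polydisc_sup n p = (SUP z\<in>{z. \<forall>i<n. cmod (z i) \<le> 1}. cmod (eval_poly id z p))"

definition von_neumann_inequality :: "(complex ^ 'k \<Rightarrow> real) \<Rightarrow> bool" where
  "von_neumann_inequality N \<longleftrightarrow>
     (\<forall>n a p. (\<forall>i<n. a i \<in> norm_ball N) \<and> in_variables n p \<longrightarrow>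
        N (eval_poly vec a p) \<le> polydisc_sup n p)"

definition von_neumann_balls :: "(complex ^ 'k) set set" where
  "von_neumann_balls = {norm_ball N | N. banach_algebra_norm N \<and> von_neumann_inequality N}"

end

theory Submission
  imports Defs "HOL-Complex_Analysis.Conformal_Mappings"
begin

text \<open>
  Inclusion. Let \<open>N\<close> satisfy the von Neumann inequality and let \<open>a 0, a 1, \<dots>\<close> be dense in its unit
  ball. The polynomials \<open>p\<close> with \<open>p(a) = f\<close> form a convex set, and by the inequality each of them has
  supremum at least \<open>N f\<close> on the polydisc. A minimax argument produces one mean \<open>\<Phi> p\<close> of \<open>\<bar>p\<bar>\<^sup>2\<close> over the
  polydisc (in effect the integral against a probability measure) with \<open>\<Phi> p \<ge> (N f)\<^sup>2\<close> for all these
  \<open>p\<close> simultaneously (\<open>separating_square_mean\<close>). Multiplying a polynomial by a coordinate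
  does not increase \<open>\<Phi>\<close>. The quotient \<open>Q v = inf {\<Phi> p | p(a) = v}\<close> is therefore the square of a
  Hilbert seminorm on \<open>\<complex>\<^sup>k\<close> on which multiplication by \<open>w\<close> has norm at most \<open>N w\<close>, while \<open>Q 1 \<le> 1\<close> and
  \<open>Q f \<ge> (N f)\<^sup>2\<close> (\<open>exists_contractive_form\<close>). This is the finite-dimensional core of the theorem of Cole
  that quotients of uniform algebras are operator algebras. A small multiple of the Euclidean norm makes \<open>Q\<close>
  definite, and the \<open>l\<^sup>2\<close> direct sum of such spaces over a countable dense set of elements \<open>f\<close> carries
  an isometric representation by coordinatewise multiplication (\<open>in_operator_algebra_balls\<close>). That sum
  is a separable Hilbert space, so it fits into every type with at least continuum many elements.

  Strictness. On the functions on the four points \<open>(\<sigma>, \<tau>) \<in> {1, -1}\<^sup>2\<close> let \<open>1, \<sigma>, \<tau>, \<sigma>\<tau>\<close> be orthogonal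
  with squared norms \<open>1, 9, 9, 81\<close>. The functions \<open>a\<^sub>i = \<kappa> (cnj \<omega>\<^sup>i \<sigma> + \<omega>\<^sup>i \<tau>)\<close>, where \<open>\<omega>\<close> is a
  primitive third root of unity and \<open>\<kappa>\<^sup>2 = 1/20\<close>, act as contractions by multiplication (\<open>form_gen_le\<close>).
  The polynomial \<open>p(x,y,z) = 2 (x\<^sup>2 + y\<^sup>2 + z\<^sup>2) - (x + y + z)\<^sup>2\<close> of Kaijser and Varopoulos is bounded by
  \<open>5\<close> on the tridisc (\<open>cmod_varopoulos_le\<close>), but \<open>p(a\<^sub>0, a\<^sub>1, a\<^sub>2) = 3/5 \<sigma>\<tau>\<close> has operator norm at least
  \<open>27/5\<close>. The remaining points are adjoined as an orthogonal sum.
\<close>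

section \<open>Quadratic seminorms and the Jordan-von Neumann theorem\<close>

text \<open>
  The infimum over \<open>t\<close> of the right-hand side of the hypothesis is \<open>(a + b)\<^sup>2\<close>. The weighted form is
  linear in the squares, so it can be summed term by term over a series.
\<close>
lemma le_square_add_if_weighted:
  fixes a b c :: real
  assumes "0 \<le> a" "0 \<le> b" and le: "\<And>t. 0 < t \<Longrightarrow> c \<le> (1 + t) * a\<^sup>2 + (1 + 1 / t) * b\<^sup>2"
  shows "c \<le> (a + b)\<^sup>2"
proof (rule field_le_epsilon)
  fix e :: real assume "0 < e"
  \<comment> \<open>the optimal weight is \<open>b / a\<close>; the shift by \<open>d\<close> keeps it positive and finite\<close>
  define d where "d = min 1 (e / (2 * (a + b + 1)))"
  have d: "0 < d" "d \<le> 1" "d * (a + b + 1) * 2 \<le> e"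
  proof -
    show "0 < d" "d \<le> 1" using assms(1,2) \<open>0 < e\<close> by (auto simp: d_def)
    have "d \<le> e / (2 * (a + b + 1))" by (simp add: d_def)
    then show "d * (a + b + 1) * 2 \<le> e" using assms(1,2) by (simp add: field_simps)
  qed
  have "c \<le> (1 + (b + d) / (a + d)) * a\<^sup>2 + (1 + (a + d) / (b + d)) * b\<^sup>2"
    using le[of "(b + d) / (a + d)"] assms(1,2) d(1) by (simp add: add_nonneg_pos)
  also have "\<dots> \<le> a\<^sup>2 + b\<^sup>2 + (b + d) * a + (a + d) * b"
  proof -
    have "a\<^sup>2 / (a + d) \<le> a" "b\<^sup>2 / (b + d) \<le> b"
      using assms(1,2) d(1) by (simp_all add: divide_simps power2_eq_square add_nonneg_pos mult_left_mono)
    then have "(b + d) * (a\<^sup>2 / (a + d)) \<le> (b + d) * a" "(a + d) * (b\<^sup>2 / (b + d)) \<le> (a + d) * b"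
      using assms(1,2) d(1) by (simp_all only: mult_left_mono add_nonneg_nonneg less_imp_le)
    then show ?thesis by (simp add: algebra_simps)
  qed
  also have "\<dots> = (a + b)\<^sup>2 + d * (a + b)" by (simp add: power2_eq_square algebra_simps)
  also have "\<dots> \<le> (a + b)\<^sup>2 + e"
  proof -
    have "0 \<le> d * (a + b)" using d(1) assms(1,2) by simp
    then show ?thesis using d(1,3) by (simp add: algebra_simps)
  qed
  finally show "c \<le> (a + b)\<^sup>2 + e" .
qed

text \<open>
  The deviation of \<open>g\<close> from linearity is additive and vanishes on the integers, so it has period \<open>1\<close>
  and is bounded everywhere; a bounded additive function is zero.
\<close>
lemma additive_bounded_imp_linear:
  fixes g :: "real \<Rightarrow> real"
  assumes add: "\<And>s t. g (s + t) = g s + g t" and bdd: "\<And>t. \<bar>t\<bar> \<le> 1 \<Longrightarrow> \<bar>g t\<bar> \<le> B"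
  shows "g t = t * g 1"
proof -
  define h where "h t = g t - t * g 1" for t
  have h_add: "h (s + t) = h s + h t" for s t by (simp add: h_def add algebra_simps)
  have h0: "h 0 = 0" using h_add[of 0 0] by simp
  have h_nat: "h (real n * t) = real n * h t" for n t
    by (induction n) (simp_all add: h0 h_add algebra_simps)
  have h_minus: "h (- t) = - h t" for t using h_add[of t "- t"] h0 by simp
  have h1: "h 1 = 0" by (simp add: h_def)
  have h_int: "h (of_int k) = 0" for k
  proof (cases "0 \<le> k")
    case True
    then show ?thesis using h_nat[of "nat k" 1] h1 by simp
  next
    case False
    then show ?thesis using h_nat[of "nat (- k)" 1] h1 h_minus[of "of_int k"] by simp
  qed
  have h_bdd: "\<bar>h t\<bar> \<le> 2 * B" for t
  proof -
    have f: "\<bar>frac t\<bar> \<le> 1" using frac_ge_0[of t] frac_lt_1[of t] by simp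
    have "h t = h (of_int \<lfloor>t\<rfloor>) + h (frac t)" by (simp add: frac_def flip: h_add)
    then have "\<bar>h t\<bar> = \<bar>g (frac t) - frac t * g 1\<bar>" by (simp only: h_int) (simp add: h_def)
    also have "\<dots> \<le> \<bar>g (frac t)\<bar> + \<bar>frac t\<bar> * \<bar>g 1\<bar>"
      using abs_triangle_ineq4[of "g (frac t)" "frac t * g 1"] by (simp add: abs_mult)
    also have "\<dots> \<le> B + 1 * B"
      using bdd[of "frac t"] bdd[of 1] f by (intro add_mono mult_mono) auto
    finally show ?thesis by simp
  qed
  \<comment> \<open>a nonzero value would grow without bound along its integer multiples\<close>
  have "h t = 0" for t
  proof (rule ccontr)
    assume "h t \<noteq> 0"
    then obtain n :: nat where n: "2 * B < real n * \<bar>h t\<bar>"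
      using ex_less_of_nat_mult[of "\<bar>h t\<bar>" "2 * B"] by auto
    have "real n * \<bar>h t\<bar> = \<bar>h (real n * t)\<bar>" by (simp add: h_nat abs_mult)
    with h_bdd[of "real n * t"] n show False by linarith
  qed
  from this[of t] show ?thesis by (simp add: h_def)
qed

lemma seminorm_le_euclidean:
  fixes N :: "complex ^ 'k \<Rightarrow> real"
  assumes scale: "\<And>c v. N (c *s v) = cmod c * N v" and triangle: "\<And>v w. N (v + w) \<le> N v + N w"
  obtains C where "0 \<le> C" "\<And>v. N v \<le> C * norm v"
proof
  let ?C = "\<Sum>i\<in>UNIV. \<bar>N (axis i 1)\<bar>"
  show "0 \<le> ?C" by (simp add: sum_nonneg)
  fix v :: "complex ^ 'k"
  have N0: "N 0 = 0" using scale[of 0 0] by simp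
  have "N (\<Sum>i\<in>S. (v $ i) *s axis i 1) \<le> (\<Sum>i\<in>S. N ((v $ i) *s axis i 1))" if "finite S" for S
    using that
  proof induction
    case (insert x S)
    then show ?case using triangle[of "(v $ x) *s axis x 1" "\<Sum>i\<in>S. (v $ i) *s axis i 1"] by simp
  qed (simp add: N0)
  from this[of UNIV] have "N v \<le> (\<Sum>i\<in>UNIV. cmod (v $ i) * N (axis i 1))"
    by (simp add: basis_expansion scale)
  also have "\<dots> \<le> (\<Sum>i\<in>UNIV. norm v * \<bar>N (axis i 1)\<bar>)"
    by (intro sum_mono order.trans[OF mult_left_mono[OF abs_ge_self] mult_right_mono])
      (simp_all add: Finite_Cartesian_Product.norm_nth_le)
  finally show "N v \<le> ?C * norm v" by (simp add: sum_distrib_left mult.commute)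
qed

text \<open>
  These are the squares of the seminorms given by positive semidefinite inner products. The axioms mention only
  \<open>Q\<close>, because pointwise limits and infima over the fibres of a linear map preserve the
  parallelogram law directly; the inner product is recovered afterwards.
\<close>
locale quadratic_seminorm =
  fixes Q :: "complex ^ 'k \<Rightarrow> real"
  assumes nonneg: "0 \<le> Q v"
    and scale: "Q (c *s v) = (cmod c)\<^sup>2 * Q v"
    and parallelogram: "Q (v + w) + Q (v - w) = 2 * Q v + 2 * Q w"
begin

lemma zero [simp]: "Q 0 = 0"
  using scale[of 0 0] by simp

lemma minus: "Q (- v) = Q v"
  using scale[of "- 1" v] by simp

lemma minus_commute: "Q (v - w) = Q (w - v)"
  using minus[of "v - w"] by simp

definition re_ip :: "complex ^ 'k \<Rightarrow> complex ^ 'k \<Rightarrow> real" where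
  "re_ip v w = (Q (v + w) - Q (v - w)) / 4"

lemma re_ip_self: "re_ip v v = Q v"
proof -
  have "v + v = 2 *s v" by (simp add: vec_eq_iff)
  then show ?thesis using scale[of 2 v] by (simp add: re_ip_def)
qed

lemma re_ip_commute: "re_ip v w = re_ip w v"
  by (simp add: re_ip_def add.commute minus_commute)

lemma re_ip_zero [simp]: "re_ip 0 w = 0"
  by (simp add: re_ip_def minus)

lemma re_ip_bound: "\<bar>re_ip v w\<bar> \<le> (Q v + Q w) / 2"
  using parallelogram[of v w] nonneg[of "v + w"] nonneg[of "v - w"] by (auto simp: re_ip_def)

lemma re_ip_add_diff: "re_ip (v + u) w + re_ip (v - u) w = 2 * re_ip v w"
proof -
  have "Q (v + u + w) + Q (v - u + w) = 2 * Q (v + w) + 2 * Q u"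
    "Q (v + u - w) + Q (v - u - w) = 2 * Q (v - w) + 2 * Q u"
    using parallelogram[of "v + w" u] parallelogram[of "v - w" u] by (simp_all add: algebra_simps)
  then show ?thesis by (simp add: re_ip_def field_simps)
qed

lemma re_ip_add: "re_ip (v + u) w = re_ip v w + re_ip u w"
proof -
  have dbl: "re_ip (x + x) w = 2 * re_ip x w" for x
    using re_ip_add_diff[of x x w] by simp
  define x y where "x = (1/2) *s (v + u)" and "y = (1/2) *s (v - u)"
  have xy: "x + y = v" "x - y = u" "x + x = v + u"
    by (simp_all add: x_def y_def vec_eq_iff field_simps)
  show ?thesis using re_ip_add_diff[of x y w] dbl[of x] unfolding xy by simp
qed

text \<open>
  Additivity alone gives rational scalars; real ones need the bound of \<open>re_ip\<close> for \<open>\<bar>t\<bar> \<le> 1\<close>.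
\<close>
lemma re_ip_scale: "re_ip (complex_of_real t *s v) w = t * re_ip v w"
proof -
  have "re_ip (complex_of_real t *s v) w = t * re_ip (complex_of_real 1 *s v) w"
  proof (rule additive_bounded_imp_linear[where B = "(Q v + Q w) / 2"])
    show "re_ip (complex_of_real (s + t) *s v) w
        = re_ip (complex_of_real s *s v) w + re_ip (complex_of_real t *s v) w" for s t
      by (simp add: vector_sadd_rdistrib re_ip_add)
    fix t :: real assume "\<bar>t\<bar> \<le> 1"
    then have "\<bar>t\<bar>\<^sup>2 * Q v \<le> 1 * Q v" by (intro mult_right_mono nonneg) (simp add: power_le_one abs_square_le_1)
    then show "\<bar>re_ip (complex_of_real t *s v) w\<bar> \<le> (Q v + Q w) / 2"
      using re_ip_bound[of "complex_of_real t *s v" w] by (simp add: scale)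
  qed
  then show ?thesis by simp
qed

lemma re_ip_i: "re_ip (\<i> *s v) (\<i> *s w) = re_ip v w"
  using scale[of \<i> "v + w"] scale[of \<i> "v - w"] by (simp add: re_ip_def vector_add_ldistrib vector_ssub_ldistrib)

definition ip :: "complex ^ 'k \<Rightarrow> complex ^ 'k \<Rightarrow> complex" where
  "ip v w = Complex (re_ip v w) (re_ip v (\<i> *s w))"

lemma re_ip_i_left: "re_ip (\<i> *s v) w = - re_ip v (\<i> *s w)"
proof -
  have "re_ip (\<i> *s v) w = re_ip (\<i> *s (\<i> *s v)) (\<i> *s w)" by (simp only: re_ip_i)
  also have "\<i> *s (\<i> *s v) = complex_of_real (- 1) *s v" by (simp add: vector_smult_assoc)
  finally show ?thesis by (simp only: re_ip_scale)
qed

lemma ip_add: "ip (v + u) w = ip v w + ip u w"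
  by (rule complex_eqI) (simp_all add: ip_def re_ip_add)

lemma ip_commute: "ip v w = cnj (ip w v)"
  using re_ip_commute[of v w] re_ip_i_left[of v w] re_ip_commute[of w "\<i> *s v"]
  by (intro complex_eqI) (simp_all add: ip_def)

lemma ip_self: "ip v v = complex_of_real (Q v)"
proof -
  have "Im (ip v v) = - Im (ip v v)" by (subst ip_commute) simp
  then show ?thesis by (simp add: complex_eq_iff ip_def re_ip_self)
qed

lemma ip_scale: "ip (c *s v) w = c * ip v w"
proof -
  have c: "c *s v = complex_of_real (Re c) *s v + complex_of_real (Im c) *s (\<i> *s v)"
    unfolding vec_eq_iff by (intro allI complex_eqI) simp_all
  have real: "ip (complex_of_real t *s u) w = complex_of_real t * ip u w" for t u
    by (rule complex_eqI) (simp_all add: ip_def re_ip_scale)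
  have imag: "ip (\<i> *s v) w = \<i> * ip v w"
    by (rule complex_eqI) (simp_all add: ip_def re_ip_i_left[of v w] re_ip_i del: vector_smult_assoc)
  have "ip (c *s v) w = (complex_of_real (Re c) + \<i> * complex_of_real (Im c)) * ip v w"
    by (subst c, simp only: ip_add real imag) (simp add: algebra_simps)
  then show ?thesis by (simp flip: complex_eq)
qed

lemma cmod_ip_le: "cmod (ip v w) \<le> Q v + Q w"
proof -
  have "cmod (ip v w) \<le> \<bar>re_ip v w\<bar> + \<bar>re_ip v (\<i> *s w)\<bar>"
    using cmod_le[of "ip v w"] by (simp add: ip_def)
  also have "\<dots> \<le> Q v + Q w"
    using re_ip_bound[of v w] re_ip_bound[of v "\<i> *s w"] by (simp add: scale)
  finally show ?thesis .
qed

lemma weighted_triangle: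
  assumes "0 < t"
  shows "Q (v + w) \<le> (1 + t) * Q v + (1 + 1 / t) * Q w"
proof -
  define r where "r = sqrt t"
  have r: "0 < r" "r\<^sup>2 = t" using assms by (simp_all add: r_def)
  let ?v = "complex_of_real r *s v" and ?w = "complex_of_real (1 / r) *s w"
  have Qv: "Q ?v = t * Q v" and Qw: "Q ?w = 1 / t * Q w"
    unfolding scale norm_of_real power2_abs using r by (simp_all add: power_one_over)
  have "re_ip ?v ?w = r * (1 / r * re_ip v w)"
    by (simp only: re_ip_scale re_ip_commute[of v ?w] re_ip_commute[of v w])
  then have "re_ip ?v ?w = re_ip v w" using r by simp
  moreover have "2 * re_ip ?v ?w \<le> Q ?v + Q ?w" using re_ip_bound[of ?v ?w] by simp
  ultimately have "2 * re_ip v w \<le> t * Q v + 1 / t * Q w" by (simp only: Qv Qw)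
  moreover have "Q (v + w) = Q v + Q w + 2 * re_ip v w"
    using parallelogram[of v w] by (simp add: re_ip_def field_simps)
  ultimately show ?thesis by (simp add: algebra_simps)
qed

lemma sqrt_triangle: "sqrt (Q (v + w)) \<le> sqrt (Q v) + sqrt (Q w)"
proof -
  have "Q (v + w) \<le> (sqrt (Q v) + sqrt (Q w))\<^sup>2"
    using weighted_triangle[of _ v w] by (intro le_square_add_if_weighted) (simp_all add: nonneg)
  then show ?thesis by (simp add: real_le_lsqrt nonneg)
qed

lemma sqrt_diff_le: "\<bar>sqrt (Q v) - sqrt (Q w)\<bar> \<le> sqrt (Q (v - w))"
  using sqrt_triangle[of "v - w" w] sqrt_triangle[of "w - v" v] by (simp add: minus_commute)

lemma sqrt_scale: "sqrt (Q (c *s v)) = cmod c * sqrt (Q v)"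
  by (simp add: scale real_sqrt_mult)

lemma tendsto:
  assumes "f \<longlonglongrightarrow> v"
  shows "(\<lambda>n. Q (f n)) \<longlonglongrightarrow> Q v"
proof -
  obtain C where C: "0 \<le> C" "\<And>v. sqrt (Q v) \<le> C * norm v"
    using seminorm_le_euclidean[of "\<lambda>v. sqrt (Q v)"] sqrt_scale sqrt_triangle by metis
  have "(\<lambda>n. sqrt (Q (f n)) - sqrt (Q v)) \<longlonglongrightarrow> 0"
  proof (rule Lim_null_comparison)
    show "\<forall>\<^sub>F n in sequentially. norm (sqrt (Q (f n)) - sqrt (Q v)) \<le> C * norm (f n - v)"
      using order.trans[OF sqrt_diff_le C(2)] by simp
    show "(\<lambda>n. C * norm (f n - v)) \<longlonglongrightarrow> 0"
      using assms by (intro tendsto_mult_right_zero tendsto_norm_zero LIM_zero)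
  qed
  then have "(\<lambda>n. sqrt (Q (f n))) \<longlonglongrightarrow> sqrt (Q v)" by (rule LIM_zero_cancel)
  then have "(\<lambda>n. (sqrt (Q (f n)))\<^sup>2) \<longlonglongrightarrow> (sqrt (Q v))\<^sup>2" by (rule tendsto_power)
  then show ?thesis by (simp add: nonneg)
qed

end

lemma quadratic_seminorm_linear:
  fixes f :: "complex ^ 'k \<Rightarrow> complex"
  assumes "\<And>v w. f (v + w) = f v + f w" "\<And>c v. f (c *s v) = c * f v"
  shows "quadratic_seminorm (\<lambda>v. (cmod (f v))\<^sup>2)"
proof
  fix v w :: "complex ^ 'k"
  have "f (v - w) = f v - f w" using assms(1)[of "v - w" w] by simp
  then show "(cmod (f (v + w)))\<^sup>2 + (cmod (f (v - w)))\<^sup>2 = 2 * (cmod (f v))\<^sup>2 + 2 * (cmod (f w))\<^sup>2"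
    by (simp add: assms(1) cmod_power2) (simp add: power2_eq_square algebra_simps)
qed (simp_all add: assms(2) norm_mult power_mult_distrib)

lemma quadratic_seminorm_add:
  assumes "quadratic_seminorm P" "quadratic_seminorm Q"
  shows "quadratic_seminorm (\<lambda>v. P v + Q v)"
proof -
  interpret P: quadratic_seminorm P by fact
  interpret Q: quadratic_seminorm Q by fact
  show ?thesis
  proof
    show "P (v + w) + Q (v + w) + (P (v - w) + Q (v - w)) = 2 * (P v + Q v) + 2 * (P w + Q w)" for v w
      using P.parallelogram[of v w] Q.parallelogram[of v w] by simp
  qed (simp_all add: P.nonneg Q.nonneg P.scale Q.scale algebra_simps)
qed

lemma quadratic_seminorm_mult:
  assumes "quadratic_seminorm Q" "0 \<le> r"
  shows "quadratic_seminorm (\<lambda>v. r * Q v)"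
proof -
  interpret Q: quadratic_seminorm Q by fact
  show ?thesis
  proof
    show "r * Q (v + w) + r * Q (v - w) = 2 * (r * Q v) + 2 * (r * Q w)" for v w
      using arg_cong[OF Q.parallelogram[of v w], of "\<lambda>x. r * x"] by (simp add: algebra_simps)
  qed (simp_all add: Q.nonneg Q.scale assms(2))
qed

lemma quadratic_seminorm_sum:
  assumes "\<And>i. i \<in> S \<Longrightarrow> quadratic_seminorm (Q i)"
  shows "quadratic_seminorm (\<lambda>v. \<Sum>i\<in>S. Q i v)"
  using assms
proof (induction S rule: infinite_finite_induct)
  case (insert i S)
  then show ?case by (simp add: quadratic_seminorm_add)
qed (simp_all add: quadratic_seminorm_def)

locale quadratic_norm = quadratic_seminorm Q for Q :: "complex ^ 'k \<Rightarrow> real" +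
  assumes definite: "\<exists>r>0. \<forall>v. r * norm v \<le> sqrt (Q v)"
begin

lemma eq_0_iff: "Q v = 0 \<longleftrightarrow> v = 0"
proof
  assume "Q v = 0"
  with definite obtain r where "0 < r" "r * norm v \<le> 0" by (metis real_sqrt_zero)
  then show "v = 0" by (simp add: mult_le_0_iff)
qed simp

end

section \<open>Operator algebra norms from families of quadratic norms\<close>

lemma mult_vec_scale: "v * (c *s w) = c *s (v * w)" and vec_scale_mult: "(c *s v) * w = c *s (v * w)" for v w :: "complex ^ 'k"
  by (simp_all add: vec_eq_iff)

text \<open>
  The Hilbert space is the \<open>l\<^sup>2\<close> direct sum of the spaces \<open>(\<complex>\<^sup>k, Q m)\<close>. Its elements are sequences of
  vectors, placed into the given type by an arbitrary injection.
\<close>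
locale l2_sum =
  fixes Q :: "nat \<Rightarrow> complex ^ 'k \<Rightarrow> real" and code :: "(nat \<Rightarrow> complex ^ 'k) \<Rightarrow> 'h"
  assumes forms: "\<And>m. quadratic_norm (Q m)"
    and inj: "inj code"
begin

sublocale form: quadratic_norm "Q m" for m
  by (rule forms)

definition ell2 :: "(nat \<Rightarrow> complex ^ 'k) set" where
  "ell2 = {x. summable (\<lambda>m. Q m (x m))}"

definition ell2_norm :: "(nat \<Rightarrow> complex ^ 'k) \<Rightarrow> real" where
  "ell2_norm x = sqrt (suminf (\<lambda>m. Q m (x m)))"

definition ip_sum :: "(nat \<Rightarrow> complex ^ 'k) \<Rightarrow> (nat \<Rightarrow> complex ^ 'k) \<Rightarrow> complex" where
  "ip_sum x y = (suminf (\<lambda>m. form.ip m (x m) (y m)))"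

lemma Q_add_le: "Q m (v + w) \<le> 2 * Q m v + 2 * Q m w"
  using form.parallelogram[of m v w] form.nonneg[of m "v - w"] by simp

lemma ell2_add [simp]: "(\<lambda>m. x m + y m) \<in> ell2" if "x \<in> ell2" "y \<in> ell2"
proof -
  have "summable (\<lambda>m. 2 * Q m (x m) + 2 * Q m (y m))"
    using that by (auto simp: ell2_def intro!: summable_add summable_mult)
  then show ?thesis
    unfolding ell2_def mem_Collect_eq
    by (rule summable_comparison_test'[where N = 0]) (simp add: Q_add_le form.nonneg)
qed

lemma ell2_scale [simp]: "(\<lambda>m. c *s x m) \<in> ell2" if "x \<in> ell2"
  using that by (simp add: ell2_def form.scale summable_mult)

lemma ell2_minus [simp]: "(\<lambda>m. - x m) \<in> ell2" if "x \<in> ell2"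
  using that by (simp add: ell2_def form.minus)

lemma ell2_diff [simp]: "(\<lambda>m. x m - y m) \<in> ell2" if "x \<in> ell2" "y \<in> ell2"
  using ell2_add[OF that(1) ell2_minus[OF that(2)]] by simp

lemma ell2_zero [simp]: "(\<lambda>m. 0) \<in> ell2"
  by (simp add: ell2_def)

lemma summable_ip: "summable (\<lambda>m. form.ip m (x m) (y m))" if "x \<in> ell2" "y \<in> ell2"
proof (rule summable_comparison_test'[where N = 0])
  show "summable (\<lambda>m. Q m (x m) + Q m (y m))"
    using that by (auto simp: ell2_def intro!: summable_add)
  show "norm (form.ip n (x n) (y n)) \<le> Q n (x n) + Q n (y n)" for n
    by (rule form.cmod_ip_le)
qed

lemma ell2_norm_nonneg: "x \<in> ell2 \<Longrightarrow> 0 \<le> ell2_norm x"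
  by (simp add: ell2_norm_def ell2_def suminf_nonneg form.nonneg)

lemma ell2_norm_sq: "(ell2_norm x)\<^sup>2 = (suminf (\<lambda>m. Q m (x m)))" if "x \<in> ell2"
  using that by (simp add: ell2_norm_def ell2_def suminf_nonneg form.nonneg)

lemma ell2_norm_minus_commute: "ell2_norm (\<lambda>m. x m - y m) = ell2_norm (\<lambda>m. y m - x m)"
  by (simp add: ell2_norm_def form.minus_commute[of _ "x _"])

lemma ell2_norm_eq_0_iff: "ell2_norm x = 0 \<longleftrightarrow> x = (\<lambda>m. 0)" if "x \<in> ell2"
  using that suminf_eq_zero_iff[of "\<lambda>m. Q m (x m)"]
  by (auto simp: ell2_norm_def ell2_def form.nonneg form.eq_0_iff fun_eq_iff)

lemma ip_sum_self: "ip_sum x x = complex_of_real ((ell2_norm x)\<^sup>2)" if "x \<in> ell2"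
  using that by (simp add: ip_sum_def form.ip_self ell2_norm_sq ell2_def suminf_of_real)

lemma ell2_norm_triangle: "ell2_norm (\<lambda>m. x m + y m) \<le> ell2_norm x + ell2_norm y" if xy: "x \<in> ell2" "y \<in> ell2"
proof -
  have s: "summable (\<lambda>m. Q m (x m))" "summable (\<lambda>m. Q m (y m))" "summable (\<lambda>m. Q m (x m + y m))"
    using xy ell2_add[OF xy] by (simp_all add: ell2_def)
  have "(ell2_norm (\<lambda>m. x m + y m))\<^sup>2 \<le> (ell2_norm x + ell2_norm y)\<^sup>2"
  proof (rule le_square_add_if_weighted)
    fix t :: real assume t: "0 < t"
    have "(suminf (\<lambda>m. Q m (x m + y m))) \<le> (suminf (\<lambda>m. (1 + t) * Q m (x m) + (1 + 1 / t) * Q m (y m)))"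
      using s t by (intro suminf_le form.weighted_triangle summable_add summable_mult)
    also have "\<dots> = (1 + t) * (suminf (\<lambda>m. Q m (x m))) + (1 + 1 / t) * (suminf (\<lambda>m. Q m (y m)))"
      using s by (simp add: suminf_add[symmetric] suminf_mult summable_mult)
    finally show "(ell2_norm (\<lambda>m. x m + y m))\<^sup>2 \<le> (1 + t) * (ell2_norm x)\<^sup>2 + (1 + 1 / t) * (ell2_norm y)\<^sup>2"
      using xy ell2_add[OF xy] by (simp add: ell2_norm_sq)
  qed (simp_all add: ell2_norm_nonneg xy)
  then show ?thesis by (rule power2_le_imp_le) (simp add: ell2_norm_nonneg xy)
qed

lemma ell2_norm_le_if_partial_sums_le:
  assumes "0 \<le> e" and le: "\<And>n. (\<Sum>m<n. Q m (x m)) \<le> e\<^sup>2"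
  shows "x \<in> ell2" "ell2_norm x \<le> e"
proof -
  have s: "summable (\<lambda>m. Q m (x m))"
    by (rule summableI_nonneg_bounded[OF form.nonneg le])
  then show "x \<in> ell2" by (simp add: ell2_def)
  have "(suminf (\<lambda>m. Q m (x m))) \<le> e\<^sup>2"
    by (rule suminf_le_const[OF s le])
  then show "ell2_norm x \<le> e"
    using assms(1) unfolding ell2_norm_def by (rule real_le_lsqrt[rotated])
qed

lemma component_le_ell2_norm: "sqrt (Q m (x m)) \<le> ell2_norm x" if "x \<in> ell2"
proof -
  have "(\<Sum>j\<in>{m}. Q j (x j)) \<le> (suminf (\<lambda>j. Q j (x j)))"
    using that by (intro sum_le_suminf) (auto simp: ell2_def form.nonneg)
  then show ?thesis by (simp add: ell2_norm_def)
qed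

text \<open>
  Each coordinate converges, because \<open>Q m\<close> dominates a multiple of the Euclidean norm. The Cauchy
  estimate passes to the limit on partial sums, where only finitely many coordinates occur.
\<close>
lemma ell2_complete:
  fixes X :: "nat \<Rightarrow> nat \<Rightarrow> complex ^ 'k"
  assumes X: "\<And>n. X n \<in> ell2"
    and cauchy: "\<And>e::real. 0 < e \<Longrightarrow> \<exists>N. \<forall>n n'. N \<le> n \<longrightarrow> N \<le> n' \<longrightarrow> ell2_norm (\<lambda>m. X n m - X n' m) < e"
  obtains x where "x \<in> ell2" "\<And>e::real. 0 < e \<Longrightarrow> \<exists>N. \<forall>n\<ge>N. ell2_norm (\<lambda>m. X n m - x m) < e"
proof -
  have "\<exists>v. (\<lambda>n. X n m) \<longlonglongrightarrow> v" for m
  proof -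
    obtain d where d: "0 < d" "\<And>v. d * norm v \<le> sqrt (Q m v)" using form.definite by blast
    have "Cauchy (\<lambda>n. X n m)"
    proof (rule metric_CauchyI)
      fix e :: real assume "0 < e"
      then obtain N where N: "\<And>n n'. N \<le> n \<Longrightarrow> N \<le> n' \<Longrightarrow> ell2_norm (\<lambda>m. X n m - X n' m) < d * e"
        using cauchy[of "d * e"] d(1) by auto
      have "dist (X n m) (X n' m) < e" if "n \<ge> N" "n' \<ge> N" for n n'
      proof -
        have "d * norm (X n m - X n' m) < d * e"
          using d(2)[of "X n m - X n' m"] component_le_ell2_norm[OF ell2_diff[OF X X], of m n n'] N[OF that]
          by linarith
        then show ?thesis using d(1) by (simp add: dist_norm)
      qed
      then show "\<exists>N. \<forall>n\<ge>N. \<forall>n'\<ge>N. dist (X n m) (X n' m) < e" by blast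
    qed
    then show ?thesis using Cauchy_convergent_iff convergent_def by blast
  qed
  then obtain x where x: "\<And>m. (\<lambda>n. X n m) \<longlonglongrightarrow> x m" by metis
  have lim: "\<exists>N. \<forall>n\<ge>N. (\<lambda>m. X n m - x m) \<in> ell2 \<and> ell2_norm (\<lambda>m. X n m - x m) < e" if "0 < e" for e
  proof -
    obtain N where N: "\<And>n n'. N \<le> n \<Longrightarrow> N \<le> n' \<Longrightarrow> ell2_norm (\<lambda>m. X n m - X n' m) < e / 2"
      using cauchy[of "e / 2"] \<open>0 < e\<close> half_gt_zero by meson
    have "(\<lambda>m. X n m - x m) \<in> ell2 \<and> ell2_norm (\<lambda>m. X n m - x m) \<le> e / 2" if n: "N \<le> n" for n
    proof -
      have "(\<Sum>m<J. Q m (X n m - x m)) \<le> (e / 2)\<^sup>2" for J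
      proof (rule tendsto_upperbound)
        show "(\<lambda>n'. \<Sum>m<J. Q m (X n m - X n' m)) \<longlonglongrightarrow> (\<Sum>m<J. Q m (X n m - x m))"
          by (intro tendsto_sum form.tendsto tendsto_diff tendsto_const x)
        have "(\<Sum>m<J. Q m (X n m - X n' m)) \<le> (e / 2)\<^sup>2" if n': "N \<le> n'" for n'
        proof -
          have "(\<Sum>m<J. Q m (X n m - X n' m)) \<le> (suminf (\<lambda>m. Q m (X n m - X n' m)))"
            using ell2_diff[OF X X] by (intro sum_le_suminf) (auto simp: ell2_def form.nonneg)
          also have "\<dots> = (ell2_norm (\<lambda>m. X n m - X n' m))\<^sup>2" by (simp add: ell2_norm_sq ell2_diff X)
          also have "\<dots> \<le> (e / 2)\<^sup>2"
            using N[OF n n'] by (intro power_mono) (simp_all add: ell2_norm_nonneg X)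
          finally show ?thesis .
        qed
        then show "\<forall>\<^sub>F n' in sequentially. (\<Sum>m<J. Q m (X n m - X n' m)) \<le> (e / 2)\<^sup>2"
          by (auto simp: eventually_sequentially)
      qed simp
      then show ?thesis using ell2_norm_le_if_partial_sums_le[of "e / 2" "\<lambda>m. X n m - x m"] \<open>0 < e\<close> by simp
    qed
    then show ?thesis using \<open>0 < e\<close> by (intro exI[of _ N]) force
  qed
  show ?thesis
  proof
    obtain N where "(\<lambda>m. X N m - x m) \<in> ell2" using lim[of 1] by auto
    from ell2_diff[OF X[of N] this] show "x \<in> ell2" by simp
    show "\<exists>N. \<forall>n\<ge>N. ell2_norm (\<lambda>m. X n m - x m) < e" if "0 < e" for e
      using lim[OF that] by blast
  qed
qed

text \<open>
  Elements that encode no square-summable sequence are treated as aliases of the zero sequence. The module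
  operations are then meaningful on the whole type, and \<open>a \<ominus> b\<close> encodes the difference of the decoded
  sequences for all \<open>a\<close> and \<open>b\<close>. This matters because \<open>Metric_space\<close> requires its distance to be
  symmetric also outside the carrier.
\<close>
definition dec :: "'h \<Rightarrow> nat \<Rightarrow> complex ^ 'k" where
  "dec a = (if a \<in> code ` ell2 then the_inv code a else (\<lambda>m. 0))"

lemma dec_code [simp]: "x \<in> ell2 \<Longrightarrow> dec (code x) = x"
  by (simp add: dec_def the_inv_f_f inj)

lemma dec_in_L [simp]: "dec a \<in> ell2"
  by (auto simp: dec_def the_inv_f_f inj ell2_zero)

lemma code_eq_iff [simp]: "code x = code y \<longleftrightarrow> x = y"
  using inj by (auto dest: injD)

definition ell2_module :: "(complex, 'h) module" where
  "ell2_module = \<lparr>carrier = code ` ell2, monoid.mult = (\<lambda>a b. a), one = code (\<lambda>m. 0), ring.zero = code (\<lambda>m. 0),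
     add = (\<lambda>a b. code (\<lambda>m. dec a m + dec b m)), smult = (\<lambda>c a. code (\<lambda>m. c *s dec a m))\<rparr>"

definition ell2_ip :: "'h \<Rightarrow> 'h \<Rightarrow> complex" where
  "ell2_ip a b = ip_sum (dec a) (dec b)"

lemma ell2_module_simps [simp]:
  "carrier ell2_module = code ` ell2" "\<zero>\<^bsub>ell2_module\<^esub> = code (\<lambda>m. 0)"
  "a \<oplus>\<^bsub>ell2_module\<^esub> b = code (\<lambda>m. dec a m + dec b m)" "c \<odot>\<^bsub>ell2_module\<^esub> a = code (\<lambda>m. c *s dec a m)"
  by (simp_all add: ell2_module_def)

lemma abelian_group_ell2: "abelian_group ell2_module"
proof (rule abelian_groupI)
  fix a assume "a \<in> carrier ell2_module"
  then obtain x where x: "a = code x" "x \<in> ell2" by auto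
  then show "\<exists>b\<in>carrier ell2_module. b \<oplus>\<^bsub>ell2_module\<^esub> a = \<zero>\<^bsub>ell2_module\<^esub>"
    by (intro bexI[of _ "code (\<lambda>m. - x m)"]) (simp_all add: ell2_minus)
qed (auto simp: ell2_add ell2_zero add_ac)

lemma diff_ell2: "a \<ominus>\<^bsub>ell2_module\<^esub> b = code (\<lambda>m. dec a m - dec b m)"
proof -
  have "\<ominus>\<^bsub>ell2_module\<^esub> b = code (\<lambda>m. - dec b m)"
    unfolding a_inv_def m_inv_def
  proof (rule the_equality)
    show "code (\<lambda>m. - dec b m) \<in> carrier (add_monoid ell2_module) \<and>
        b \<otimes>\<^bsub>add_monoid ell2_module\<^esub> code (\<lambda>m. - dec b m) = \<one>\<^bsub>add_monoid ell2_module\<^esub> \<and>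
        code (\<lambda>m. - dec b m) \<otimes>\<^bsub>add_monoid ell2_module\<^esub> b = \<one>\<^bsub>add_monoid ell2_module\<^esub>"
      by (simp add: ell2_minus)
    show "c = code (\<lambda>m. - dec b m)"
      if "c \<in> carrier (add_monoid ell2_module) \<and> b \<otimes>\<^bsub>add_monoid ell2_module\<^esub> c = \<one>\<^bsub>add_monoid ell2_module\<^esub> \<and>
        c \<otimes>\<^bsub>add_monoid ell2_module\<^esub> b = \<one>\<^bsub>add_monoid ell2_module\<^esub>" for c
      using that by (auto simp: fun_eq_iff eq_neg_iff_add_eq_0)
  qed
  then show ?thesis by (simp add: a_minus_def ell2_minus)
qed

lemma cring_complex_field: "cring complex_field"
proof (rule cringI)
  show "abelian_group complex_field"
  proof (rule abelian_groupI)
    show "\<exists>y\<in>carrier complex_field. y \<oplus>\<^bsub>complex_field\<^esub> x = \<zero>\<^bsub>complex_field\<^esub>" for x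
      by (intro bexI[of _ "- x"]) (simp_all add: complex_field_def)
  qed (auto simp: complex_field_def)
  show "comm_monoid complex_field"
    by (rule comm_monoidI) (auto simp: complex_field_def)
qed (auto simp: complex_field_def algebra_simps)

lemma module_ell2: "module complex_field ell2_module"
  by (rule moduleI[OF cring_complex_field abelian_group_ell2])
    (auto simp: ell2_scale complex_field_def vector_sadd_rdistrib vector_add_ldistrib)

lemma inner_product_ell2: "complex_inner_product_space ell2_module ell2_ip"
proof (intro complex_inner_product_space.intro module_ell2 complex_inner_product_space_axioms.intro)
  fix a b c z
  show "ell2_ip (a \<oplus>\<^bsub>ell2_module\<^esub> b) c = ell2_ip a c + ell2_ip b c" if "a \<in> carrier ell2_module" "b \<in> carrier ell2_module" "c \<in> carrier ell2_module"
    using that by (auto simp: ell2_ip_def ip_sum_def form.ip_add suminf_add summable_ip)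
  show "ell2_ip (z \<odot>\<^bsub>ell2_module\<^esub> a) b = z * ell2_ip a b" if "a \<in> carrier ell2_module" "b \<in> carrier ell2_module"
    using that by (auto simp: ell2_ip_def ip_sum_def form.ip_scale suminf_mult summable_ip)
  show "ell2_ip a b = cnj (ell2_ip b a)" if ab: "a \<in> carrier ell2_module" "b \<in> carrier ell2_module"
  proof -
    obtain x y where x: "a = code x" "x \<in> ell2" "b = code y" "y \<in> ell2" using ab by auto
    have "(\<lambda>m. cnj (form.ip m (y m) (x m))) sums cnj (suminf (\<lambda>m. form.ip m (y m) (x m)))"
      using summable_sums[OF summable_ip[OF x(4,2)]] by (simp only: sums_cnj)
    then show ?thesis
      by (simp add: x ell2_ip_def ip_sum_def sums_iff flip: form.ip_commute)
  qed
  assume "a \<in> carrier ell2_module"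
  then obtain x where x: "a = code x" "x \<in> ell2" by auto
  show "0 \<le> Re (ell2_ip a a)" using x by (simp add: ell2_ip_def ip_sum_self)
  show "a = \<zero>\<^bsub>ell2_module\<^esub>" if "ell2_ip a a = 0" using that x by (simp add: ell2_ip_def ip_sum_self ell2_norm_eq_0_iff)
qed

lemma ip_norm_ell2 [simp]: "x \<in> ell2 \<Longrightarrow> ip_norm ell2_ip (code x) = ell2_norm x"
  by (simp add: ip_norm_def ell2_ip_def ip_sum_self ell2_norm_nonneg)

lemma hilbert_space_ell2: "complex_hilbert_space ell2_module ell2_ip"
proof (intro complex_hilbert_space.intro inner_product_ell2 complex_hilbert_space_axioms.intro)
  have d: "ip_norm ell2_ip (a \<ominus>\<^bsub>ell2_module\<^esub> b) = ell2_norm (\<lambda>m. dec a m - dec b m)" for a b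
    by (simp add: diff_ell2 ell2_diff)
  interpret Metric_space "carrier ell2_module" "\<lambda>a b. ip_norm ell2_ip (a \<ominus>\<^bsub>ell2_module\<^esub> b)"
    unfolding d
  proof
    fix a b c
    show "0 \<le> ell2_norm (\<lambda>m. dec a m - dec b m)" by (simp add: ell2_norm_nonneg)
    show "ell2_norm (\<lambda>m. dec a m - dec b m) = ell2_norm (\<lambda>m. dec b m - dec a m)" by (rule ell2_norm_minus_commute)
    show "ell2_norm (\<lambda>m. dec a m - dec b m) = 0 \<longleftrightarrow> a = b" if "a \<in> carrier ell2_module" "b \<in> carrier ell2_module"
      using that by (auto simp: ell2_norm_eq_0_iff ell2_diff fun_eq_iff)
    show "ell2_norm (\<lambda>m. dec a m - dec c m) \<le> ell2_norm (\<lambda>m. dec a m - dec b m) + ell2_norm (\<lambda>m. dec b m - dec c m)"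
      using ell2_norm_triangle[of "\<lambda>m. dec a m - dec b m" "\<lambda>m. dec b m - dec c m"] by (simp add: ell2_diff)
  qed
  show "mcomplete"
    unfolding mcomplete_def MCauchy_def limit_metric_sequentially
    unfolding d
  proof (intro allI impI, elim conjE)
    fix \<sigma> :: "nat \<Rightarrow> 'h"
    assume \<sigma>: "range \<sigma> \<subseteq> carrier ell2_module"
      and cauchy: "\<forall>e>0. \<exists>N. \<forall>n n'. N \<le> n \<longrightarrow> N \<le> n' \<longrightarrow> ell2_norm (\<lambda>m. dec (\<sigma> n) m - dec (\<sigma> n') m) < e"
    obtain x where x: "x \<in> ell2" "\<And>e. 0 < e \<Longrightarrow> \<exists>N. \<forall>n\<ge>N. ell2_norm (\<lambda>m. dec (\<sigma> n) m - x m) < e"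
    proof (rule ell2_complete[of "\<lambda>n. dec (\<sigma> n)"])
      show "\<exists>N. \<forall>n n'. N \<le> n \<longrightarrow> N \<le> n' \<longrightarrow> ell2_norm (\<lambda>m. dec (\<sigma> n) m - dec (\<sigma> n') m) < e"
        if "0 < e" for e using cauchy \<open>0 < e\<close> by blast
    qed auto
    have \<sigma>': "\<sigma> n \<in> code ` ell2" for n using \<sigma> by auto
    show "\<exists>a. a \<in> carrier ell2_module \<and> (\<forall>e>0. \<exists>N. \<forall>n\<ge>N. \<sigma> n \<in> carrier ell2_module \<and> ell2_norm (\<lambda>m. dec (\<sigma> n) m - dec a m) < e)"
      using x \<sigma>' by (intro exI[of _ "code x"]) simp
  qed
qed

definition rep :: "complex ^ 'k \<Rightarrow> 'h \<Rightarrow> 'h" where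
  "rep v a = code (\<lambda>m. v * dec a m)"

context
  fixes N :: "complex ^ 'k \<Rightarrow> real"
  assumes N_nonneg: "\<And>w. 0 \<le> N w"
    and contractive: "\<And>m w v. sqrt (Q m (w * v)) \<le> N w * sqrt (Q m v)"
begin

lemma ell2_mult: "x \<in> ell2 \<Longrightarrow> (\<lambda>m. w * x m) \<in> ell2"
  and ell2_norm_mult_le: "x \<in> ell2 \<Longrightarrow> ell2_norm (\<lambda>m. w * x m) \<le> N w * ell2_norm x"
proof -
  assume x: "x \<in> ell2"
  have "(\<Sum>m<n. Q m (w * x m)) \<le> (N w * ell2_norm x)\<^sup>2" for n
  proof -
    have "Q m (w * x m) \<le> (N w)\<^sup>2 * Q m (x m)" for m
    proof -
      have "(sqrt (Q m (w * x m)))\<^sup>2 \<le> (N w * sqrt (Q m (x m)))\<^sup>2"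
        by (intro power_mono contractive) (simp add: form.nonneg)
      then show ?thesis by (simp add: power_mult_distrib form.nonneg)
    qed
    then have "(\<Sum>m<n. Q m (w * x m)) \<le> (N w)\<^sup>2 * (\<Sum>m<n. Q m (x m))"
      by (simp add: sum_distrib_left sum_mono)
    also have "\<dots> \<le> (N w)\<^sup>2 * (ell2_norm x)\<^sup>2"
      using x by (simp add: ell2_norm_sq ell2_def form.nonneg sum_le_suminf mult_left_mono)
    finally show ?thesis by (simp add: power_mult_distrib)
  qed
  from ell2_norm_le_if_partial_sums_le[OF _ this] 
  show "(\<lambda>m. w * x m) \<in> ell2" "ell2_norm (\<lambda>m. w * x m) \<le> N w * ell2_norm x"
    by (simp_all add: N_nonneg ell2_norm_nonneg x)
qed

lemma unital_representation_rep: "unital_representation ell2_module ell2_ip rep"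
proof -
  have rep_code: "rep v (code x) = code (\<lambda>m. v * x m)" if "x \<in> ell2" for v x
    using that by (simp add: rep_def)
  have "bounded_operator ell2_module ell2_ip (rep v)" for v
    unfolding bounded_operator_def
  proof (intro conjI exI[of _ "N v"] ballI allI)
    fix a b c assume "a \<in> carrier ell2_module" "b \<in> carrier ell2_module"
    then obtain x y where xy: "a = code x" "x \<in> ell2" "b = code y" "y \<in> ell2" by auto
    show "rep v a \<in> carrier ell2_module" using xy by (simp add: rep_code ell2_mult)
    show "rep v (a \<oplus>\<^bsub>ell2_module\<^esub> b) = rep v a \<oplus>\<^bsub>ell2_module\<^esub> rep v b"
      using xy by (simp add: rep_code ell2_mult distrib_left)
    show "rep v (c \<odot>\<^bsub>ell2_module\<^esub> a) = c \<odot>\<^bsub>ell2_module\<^esub> rep v a"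
      using xy by (simp add: rep_code ell2_mult mult_vec_scale)
    show "ip_norm ell2_ip (rep v a) \<le> N v * ip_norm ell2_ip a"
      using xy by (simp add: rep_code ell2_mult ell2_norm_mult_le)
  qed
  moreover have "rep 1 a = a" "rep (v + w) a = rep v a \<oplus>\<^bsub>ell2_module\<^esub> rep w a"
    "rep (c *s v) a = c \<odot>\<^bsub>ell2_module\<^esub> rep v a" "rep (v * w) a = rep v (rep w a)"
    if a: "a \<in> carrier ell2_module" for a c v w
  proof -
    obtain x where x: "a = code x" "x \<in> ell2" using a by auto
    show "rep 1 a = a" using x by (simp add: rep_code)
    show "rep (v + w) a = rep v a \<oplus>\<^bsub>ell2_module\<^esub> rep w a" using x by (simp add: rep_code ell2_mult distrib_right)
    show "rep (c *s v) a = c \<odot>\<^bsub>ell2_module\<^esub> rep v a" using x by (simp add: rep_code ell2_mult vec_scale_mult)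
    show "rep (v * w) a = rep v (rep w a)" using x by (simp add: rep_code ell2_mult mult.assoc)
  qed
  ultimately show ?thesis
    unfolding unital_representation_def by blast
qed

text \<open>
  A vector on which \<open>w\<close> almost attains its norm in the space \<open>(\<complex>\<^sup>k, Q m)\<close> is used as the \<open>m\<close>-th
  component of a sequence that vanishes elsewhere.
\<close>
lemma operator_norm_rep:
  assumes attained: "\<And>e. 0 < e \<Longrightarrow> \<exists>m v. Q m v \<le> 1 \<and> N w - e \<le> sqrt (Q m (w * v))"
  shows "operator_norm ell2_module ell2_ip (rep w) = N w"
  unfolding operator_norm_def
proof (rule cSup_eq_non_empty)
  show "(\<lambda>a. ip_norm ell2_ip (rep w a)) ` {a \<in> carrier ell2_module. ip_norm ell2_ip a \<le> 1} \<noteq> {}"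
    using ell2_norm_eq_0_iff[OF ell2_zero] by (auto intro!: bexI[OF _ ell2_zero])
  fix r assume "r \<in> (\<lambda>a. ip_norm ell2_ip (rep w a)) ` {a \<in> carrier ell2_module. ip_norm ell2_ip a \<le> 1}"
  then obtain x where x: "x \<in> ell2" "ell2_norm x \<le> 1" "r = ell2_norm (\<lambda>m. w * x m)"
    by (auto simp: rep_def ell2_mult)
  show "r \<le> N w"
    using ell2_norm_mult_le[OF x(1), of w] mult_left_mono[OF x(2) N_nonneg[of w]] x(3) by simp
next
  fix b assume b: "\<And>r. r \<in> (\<lambda>a. ip_norm ell2_ip (rep w a)) ` {a \<in> carrier ell2_module. ip_norm ell2_ip a \<le> 1} \<Longrightarrow> r \<le> b"
  show "N w \<le> b"
  proof (rule field_le_epsilon)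
    fix e :: real assume "0 < e"
    then obtain m v where v: "Q m v \<le> 1" "N w - e \<le> sqrt (Q m (w * v))" using attained by blast
    define x where "x j = (if j = m then v else 0)" for j
    have Qx: "Q j (x j) = (if j = m then Q m v else 0)" for j by (simp add: x_def)
    have "(\<Sum>j<n. Q j (x j)) \<le> 1\<^sup>2" for n
      using v(1) by (simp add: Qx)
    from ell2_norm_le_if_partial_sums_le[OF _ this] have x: "x \<in> ell2" "ell2_norm x \<le> 1" by simp_all
    have "sqrt (Q m (w * v)) \<le> ell2_norm (\<lambda>j. w * x j)"
      using component_le_ell2_norm[OF ell2_mult[OF x(1)], of m w] by (simp add: x_def)
    also have "ell2_norm (\<lambda>j. w * x j) \<le> b"
      using x by (intro b image_eqI[of _ _ "code x"]) (simp_all add: rep_def ell2_mult)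
    finally show "N w \<le> b + e" using v(2) by simp
  qed
qed

end

end

lemma lepoll_vector_sequences: "(UNIV :: (nat \<Rightarrow> complex ^ 'k) set) \<lesssim> (UNIV :: (nat \<Rightarrow> complex) set)"
proof -
  obtain f :: "'k \<Rightarrow> nat" where f: "inj f" using finite_imp_inj_to_nat_seg[of "UNIV :: 'k set"] by auto
  define g where "g x = (\<lambda>n. x (fst (prod_decode n)) $ inv_into UNIV f (snd (prod_decode n)))"
    for x :: "nat \<Rightarrow> complex ^ 'k"
  have "inj g"
  proof (rule injI)
    fix x y assume xy: "g x = g y"
    have "x m $ i = y m $ i" for m i
      using fun_cong[OF xy, of "prod_encode (m, f i)"] f by (simp add: g_def)
    then show "x = y" by (simp add: fun_eq_iff vec_eq_iff)
  qed
  then show ?thesis by (auto simp: lepoll_def)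
qed

text \<open>
  The criterion for membership in \<open>\<O>\<^sub>k\<close> used for both halves of the theorem: a norm that is the
  supremum of the operator norms of multiplication for countably many quadratic norms is an operator
  algebra norm.
\<close>
lemma in_operator_algebra_balls:
  fixes Q :: "nat \<Rightarrow> complex ^ 'k \<Rightarrow> real"
  assumes card: "(UNIV :: (nat \<Rightarrow> complex) set) \<lesssim> (UNIV :: 'h set)"
    and N: "banach_algebra_norm N"
    and Q: "\<And>m. quadratic_norm (Q m)"
    and le: "\<And>m w v. sqrt (Q m (w * v)) \<le> N w * sqrt (Q m v)"
    and attained: "\<And>w e. 0 < e \<Longrightarrow> \<exists>m v. Q m v \<le> 1 \<and> N w - e \<le> sqrt (Q m (w * v))"
  shows "norm_ball N \<in> operator_algebra_balls TYPE('h)"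
proof -
  obtain code :: "(nat \<Rightarrow> complex ^ 'k) \<Rightarrow> 'h" where "inj code"
    using lepoll_trans[OF lepoll_vector_sequences card] by (auto simp: lepoll_def)
  interpret l2_sum Q code by (rule l2_sum.intro) fact+
  have N_nonneg: "0 \<le> N w" for w using N by (simp add: banach_algebra_norm_def)
  show ?thesis
    unfolding operator_algebra_balls_def mem_Collect_eq
  proof (intro exI[of _ N] conjI refl N exI[of _ ell2_module] exI[of _ ell2_ip] exI[of _ rep] allI)
    show "complex_hilbert_space ell2_module ell2_ip" by (rule hilbert_space_ell2)
    show "unital_representation ell2_module ell2_ip rep" by (rule unital_representation_rep[OF N_nonneg le])
    show "operator_norm ell2_module ell2_ip (rep w) = N w" for w
      by (rule operator_norm_rep[OF N_nonneg le attained])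
  qed
qed

section \<open>Evaluation of polynomials\<close>

lemma cpoly_induct [case_names zero add]:
  fixes p :: "'m \<Rightarrow>\<^sub>0 'c::comm_monoid_add"
  assumes "P 0" and add: "\<And>p m c. P p \<Longrightarrow> P (p + Poly_Mapping.single m c)"
  shows "P p"
proof (induction p rule: Poly_Mapping.update_induct)
  case const
  then show ?case using assms(1) by simp
next
  case (update p m c)
  have "Poly_Mapping.update m c p = p + Poly_Mapping.single m c"
    using update(1) by (intro poly_mapping_eqI)
      (auto simp: lookup_update lookup_add lookup_single in_keys_iff when_def)
  then show ?case using add[OF update(3)] by simp
qed

definition monom_value :: "(nat \<Rightarrow> 'a::comm_ring_1) \<Rightarrow> (nat \<Rightarrow>\<^sub>0 nat) \<Rightarrow> 'a" where
  "monom_value a m = (\<Prod>i\<in>Poly_Mapping.keys m. a i ^ Poly_Mapping.lookup m i)"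

lemma monom_value_superset:
  assumes "finite S" "Poly_Mapping.keys m \<subseteq> S"
  shows "monom_value a m = (\<Prod>i\<in>S. a i ^ Poly_Mapping.lookup m i)"
  unfolding monom_value_def by (rule prod.mono_neutral_left) (use assms in \<open>auto simp: in_keys_iff\<close>)

lemma monom_value_add: "monom_value a (m + m') = monom_value a m * monom_value a m'"
proof -
  let ?S = "Poly_Mapping.keys m \<union> Poly_Mapping.keys m'"
  have "monom_value a (m + m') = (\<Prod>i\<in>?S. a i ^ Poly_Mapping.lookup (m + m') i)"
    by (rule monom_value_superset) (auto dest: subsetD[OF Poly_Mapping.keys_add])
  also have "\<dots> = (\<Prod>i\<in>?S. a i ^ Poly_Mapping.lookup m i) * (\<Prod>i\<in>?S. a i ^ Poly_Mapping.lookup m' i)"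
    by (simp add: lookup_add power_add prod.distrib)
  also have "\<dots> = monom_value a m * monom_value a m'"
    by (subst (1 2) monom_value_superset[of ?S]) auto
  finally show ?thesis .
qed

definition const :: "complex \<Rightarrow> cpoly" where
  "const c = Poly_Mapping.single 0 c"

definition var :: "nat \<Rightarrow> cpoly" where
  "var i = Poly_Mapping.single (Poly_Mapping.single i 1) 1"

context
  fixes \<phi> :: "complex \<Rightarrow> 'a::comm_ring_1"
  assumes hom_add: "\<And>x y. \<phi> (x + y) = \<phi> x + \<phi> y" and hom_mult: "\<And>x y. \<phi> (x * y) = \<phi> x * \<phi> y"
    and hom_one: "\<phi> 1 = 1"
begin

lemma hom_zero: "\<phi> 0 = 0"
  using hom_add[of 0 0] by simp

lemma eval_poly_superset:
  assumes "finite S" "Poly_Mapping.keys p \<subseteq> S"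
  shows "eval_poly \<phi> a p = (\<Sum>m\<in>S. \<phi> (Poly_Mapping.lookup p m) * monom_value a m)"
  unfolding eval_poly_def monom_value_def[symmetric]
  by (rule sum.mono_neutral_left) (use assms in \<open>auto simp: in_keys_iff hom_zero\<close>)

lemma eval_poly_add: "eval_poly \<phi> a (p + q) = eval_poly \<phi> a p + eval_poly \<phi> a q"
proof -
  let ?S = "Poly_Mapping.keys p \<union> Poly_Mapping.keys q"
  have "eval_poly \<phi> a (p + q) = (\<Sum>m\<in>?S. \<phi> (Poly_Mapping.lookup (p + q) m) * monom_value a m)"
    by (rule eval_poly_superset) (auto dest: subsetD[OF Poly_Mapping.keys_add])
  also have "\<dots> = eval_poly \<phi> a p + eval_poly \<phi> a q"
    by (subst (1 2) eval_poly_superset[of ?S])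
      (auto simp: lookup_add hom_add distrib_right sum.distrib)
  finally show ?thesis .
qed

lemma eval_poly_zero: "eval_poly \<phi> a 0 = 0"
  by (simp add: eval_poly_def)

lemma eval_poly_single: "eval_poly \<phi> a (Poly_Mapping.single m c) = \<phi> c * monom_value a m"
  by (subst eval_poly_superset[of "{m}"]) auto

lemma eval_poly_mult: "eval_poly \<phi> a (p * q) = eval_poly \<phi> a p * eval_poly \<phi> a q"
proof (induction p rule: cpoly_induct)
  case (add p m c)
  have "eval_poly \<phi> a (Poly_Mapping.single m c * q) = eval_poly \<phi> a (Poly_Mapping.single m c) * eval_poly \<phi> a q"
  proof (induction q rule: cpoly_induct)
    case (add q m' c')
    then show ?case
      by (simp add: distrib_left eval_poly_add mult_single)
        (simp add: eval_poly_single hom_mult monom_value_add mult_ac)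
  qed (simp add: eval_poly_zero)
  then show ?case using add by (simp add: distrib_right eval_poly_add)
qed (simp add: eval_poly_zero)

lemma eval_poly_const: "eval_poly \<phi> a (const c) = \<phi> c"
  by (simp add: const_def eval_poly_single monom_value_def)

lemma eval_poly_one: "eval_poly \<phi> a 1 = 1"
  using eval_poly_const[of a 1] by (simp add: const_def hom_one)

lemma eval_poly_diff: "eval_poly \<phi> a (p - q) = eval_poly \<phi> a p - eval_poly \<phi> a q"
  using eval_poly_add[of a "p - q" q] by simp

lemma eval_poly_sum: "eval_poly \<phi> a (\<Sum>i\<in>S. p i) = (\<Sum>i\<in>S. eval_poly \<phi> a (p i))"
  by (induction S rule: infinite_finite_induct) (simp_all add: eval_poly_add eval_poly_zero)

lemma eval_poly_var: "eval_poly \<phi> a (var i) = a i"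
  by (simp add: var_def eval_poly_single monom_value_def hom_one)

end

lemma vec_hom: "vec (x + y) = (vec x + vec y :: complex ^ 'k)" "vec (x * y) = (vec x * vec y :: complex ^ 'k)"
  "vec 1 = (1 :: complex ^ 'k)"
  by (simp_all add: vec_eq_iff)

lemma id_hom: "id (x + y) = id x + id y" "id (x * y) = id x * id y" "id 1 = 1" for x y :: complex
  by simp_all

lemma vec_mult: "vec c * v = c *s v"
  by (simp add: vec_eq_iff)

lemmas eval_vec = eval_poly_add[of vec, OF vec_hom] eval_poly_mult[of vec, OF vec_hom]
  eval_poly_diff[of vec, OF vec_hom] eval_poly_const[of vec, OF vec_hom] eval_poly_one[of vec, OF vec_hom]
  eval_poly_sum[of vec, OF vec_hom] eval_poly_var[of vec, OF vec_hom] vec_mult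

lemmas eval_id = eval_poly_add[of id, OF id_hom] eval_poly_mult[of id, OF id_hom]
  eval_poly_diff[of id, OF id_hom] eval_poly_const[of id, OF id_hom] eval_poly_one[of id, OF id_hom]
  eval_poly_sum[of id, OF id_hom] eval_poly_var[of id, OF id_hom]

lemma eval_poly_cong_variables:
  assumes "in_variables n p" "\<And>i. i < n \<Longrightarrow> z i = z' i"
  shows "eval_poly \<phi> z p = eval_poly \<phi> z' p"
  unfolding eval_poly_def
  using assms by (intro sum.cong prod.cong arg_cong2[of _ _ _ _ "(*)"] arg_cong2[of _ _ _ _ "(^)"] refl)
    (auto simp: in_variables_def)

lemma in_variables_exists: "\<exists>n. in_variables n p"
proof -
  have "finite (\<Union>m\<in>Poly_Mapping.keys p. Poly_Mapping.keys m)" by simp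
  then obtain n where "(\<Union>m\<in>Poly_Mapping.keys p. Poly_Mapping.keys m) \<subseteq> {..<n}"
    using finite_nat_iff_bounded by blast
  then show ?thesis by (auto simp: in_variables_def)
qed

definition coeff_norm :: "cpoly \<Rightarrow> real" where
  "coeff_norm p = (\<Sum>m\<in>Poly_Mapping.keys p. cmod (Poly_Mapping.lookup p m))"

lemma cmod_eval_le_coeff_norm:
  assumes "in_variables n p" "\<And>i. i < n \<Longrightarrow> cmod (z i) \<le> 1"
  shows "cmod (eval_poly id z p) \<le> coeff_norm p"
proof -
  have "cmod (\<Prod>i\<in>Poly_Mapping.keys m. z i ^ Poly_Mapping.lookup m i) \<le> 1" if "m \<in> Poly_Mapping.keys p" for m
    unfolding prod_norm[symmetric] norm_power
  proof (intro prod_le_1 conjI power_le_one assms(2))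
    show "i < n" if "i \<in> Poly_Mapping.keys m" for i
      using assms(1) \<open>m \<in> Poly_Mapping.keys p\<close> that by (auto simp: in_variables_def)
  qed simp_all
  then have "cmod (eval_poly id z p) \<le> (\<Sum>m\<in>Poly_Mapping.keys p. cmod (Poly_Mapping.lookup p m) * 1)"
    unfolding eval_poly_def
    by (intro sum_norm_le) (simp only: norm_mult id_apply mult_left_mono norm_ge_zero)
  then show ?thesis by (simp add: coeff_norm_def)
qed

section \<open>A minimax principle for finitely many functionals\<close>

text \<open>
  A finite-dimensional separation theorem in which the dimension is the size of a finite set. Let \<open>h\<close>
  nearly minimise the sum of the squared shortfalls \<open>max 0 (b - h i)\<close>. A small step
  from \<open>h\<close> towards another member \<open>g\<close> cannot lower this sum noticeably, and the resulting first-order condition is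
  the asserted inequality for \<open>g\<close>, with weights proportional to the shortfalls of \<open>h\<close>.
\<close>
lemma finite_minimax:
  fixes \<H> :: "('i \<Rightarrow> real) set"
  assumes fin: "finite I" and ne: "\<H> \<noteq> {}"
    and conv: "\<And>h g t. h \<in> \<H> \<Longrightarrow> g \<in> \<H> \<Longrightarrow> 0 \<le> t \<Longrightarrow> t \<le> 1 \<Longrightarrow> (\<lambda>i. (1 - t) * h i + t * g i) \<in> \<H>"
    and bdd: "\<And>h i. h \<in> \<H> \<Longrightarrow> i \<in> I \<Longrightarrow> \<bar>h i\<bar> \<le> K"
    and e: "0 < e" and below: "\<And>h. h \<in> \<H> \<Longrightarrow> \<exists>i\<in>I. h i < b - e"
  obtains \<alpha> s where "\<And>i. i \<in> I \<Longrightarrow> 0 \<le> \<alpha> i" "(\<Sum>i\<in>I. \<alpha> i) = 1" "s < b"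
    "\<And>h. h \<in> \<H> \<Longrightarrow> (\<Sum>i\<in>I. \<alpha> i * h i) \<le> s"
proof -
  define \<Psi> where "\<Psi> h = (\<Sum>i\<in>I. (max 0 (b - h i))\<^sup>2)" for h
  define C where "C = (\<Sum>i\<in>I. (2 * K)\<^sup>2)"
  have C: "0 \<le> C" by (simp add: C_def sum_nonneg)
  have \<Psi>_ge: "e\<^sup>2 \<le> \<Psi> h" if h: "h \<in> \<H>" for h
  proof -
    obtain i where i: "i \<in> I" "h i < b - e" using below h by blast
    have "e\<^sup>2 \<le> (max 0 (b - h i))\<^sup>2" using i(2) e by (intro power_mono) auto
    also have "\<dots> \<le> \<Psi> h" unfolding \<Psi>_def using i(1) fin by (intro member_le_sum) auto
    finally show ?thesis .
  qed
  have bb: "bdd_below (\<Psi> ` \<H>)" using \<Psi>_ge by (intro bdd_belowI2) auto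
  \<comment> \<open>the second-order error \<open>t * C / 2\<close> of a step of length \<open>t\<close> is at most \<open>e\<^sup>2 / 8\<close>\<close>
  define t where "t = min 1 (e\<^sup>2 / (4 * (C + 1)))"
  have t: "0 < t" "t \<le> 1" "t * C \<le> e\<^sup>2 / 4"
  proof -
    show "0 < t" "t \<le> 1" using e C by (auto simp: t_def)
    have "t * (C + 1) \<le> e\<^sup>2 / (4 * (C + 1)) * (C + 1)"
      using C by (intro mult_right_mono) (auto simp: t_def)
    also have "\<dots> = e\<^sup>2 / 4" using C by (simp add: divide_simps)
    finally show "t * C \<le> e\<^sup>2 / 4" using \<open>0 < t\<close> by (simp add: algebra_simps)
  qed
  have "Inf (\<Psi> ` \<H>) < Inf (\<Psi> ` \<H>) + t * e\<^sup>2 / 4" using t(1) e by simp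
  then obtain h where h: "h \<in> \<H>" "\<Psi> h < Inf (\<Psi> ` \<H>) + t * e\<^sup>2 / 4"
    using cInf_lessD[of "\<Psi> ` \<H>"] ne by blast
  define \<beta> where "\<beta> i = max 0 (b - h i)" for i
  define A where "A = (\<Sum>i\<in>I. \<beta> i)"
  have A: "0 < A"
  proof -
    obtain i where i: "i \<in> I" "h i < b - e" using below h(1) by blast
    have "0 < \<beta> i" using i(2) e by (simp add: \<beta>_def)
    also have "\<beta> i \<le> A" unfolding A_def using i(1) fin by (intro member_le_sum) (auto simp: \<beta>_def)
    finally show ?thesis .
  qed
  have main: "(\<Sum>i\<in>I. \<beta> i * g i) \<le> b * A - 3 / 4 * e\<^sup>2" if g: "g \<in> \<H>" for g
  proof -
    let ?y = "\<lambda>i. g i - h i"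
    have "\<Psi> h - t * e\<^sup>2 / 4 < \<Psi> (\<lambda>i. (1 - t) * h i + t * g i)"
      using h(2) cInf_lower[OF imageI[OF conv[OF h(1) g]] bb, of t] t by auto
    also have "\<dots> \<le> (\<Sum>i\<in>I. (\<beta> i)\<^sup>2 - 2 * t * (\<beta> i * ?y i) + t\<^sup>2 * (2 * K)\<^sup>2)"
      unfolding \<Psi>_def
    proof (rule sum_mono)
      fix i assume i: "i \<in> I"
      \<comment> \<open>the square of the positive part has a 2-Lipschitz derivative\<close>
      have quad: "(max 0 (x - y))\<^sup>2 \<le> (max 0 x)\<^sup>2 - 2 * y * max 0 x + y\<^sup>2" for x y :: real
      proof (cases "0 \<le> x")
        case True
        have "(max 0 (x - y))\<^sup>2 \<le> (x - y)\<^sup>2" by (auto simp: max_def)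
        also have "\<dots> = x\<^sup>2 - 2 * y * x + y\<^sup>2" by (simp add: power2_diff)
        finally show ?thesis using True by simp
      next
        case False
        then have "max 0 (x - y) \<le> \<bar>y\<bar>" by auto
        from power_mono[OF this, of 2] show ?thesis using False by (simp add: max_def)
      qed
      have "\<bar>?y i\<bar> \<le> 2 * K" using bdd[OF g i] bdd[OF h(1) i] by linarith
      from power_mono[OF this, of 2] have "(?y i)\<^sup>2 \<le> (2 * K)\<^sup>2" by simp
      then have "t\<^sup>2 * (?y i)\<^sup>2 \<le> t\<^sup>2 * (2 * K)\<^sup>2" by (simp add: mult_left_mono)
      then show "(max 0 (b - ((1 - t) * h i + t * g i)))\<^sup>2 \<le> (\<beta> i)\<^sup>2 - 2 * t * (\<beta> i * ?y i) + t\<^sup>2 * (2 * K)\<^sup>2"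
      proof -
        have "b - ((1 - t) * h i + t * g i) = (b - h i) - t * ?y i" by (simp add: algebra_simps)
        then have "(max 0 (b - ((1 - t) * h i + t * g i)))\<^sup>2 \<le> (\<beta> i)\<^sup>2 - 2 * (t * ?y i) * \<beta> i + (t * ?y i)\<^sup>2"
          using quad[of "b - h i" "t * ?y i"] by (simp only: \<beta>_def)
        with \<open>t\<^sup>2 * (?y i)\<^sup>2 \<le> t\<^sup>2 * (2 * K)\<^sup>2\<close> show ?thesis
          by (simp only: power_mult_distrib mult_ac)
      qed
    qed
    also have "\<dots> = \<Psi> h - 2 * t * (\<Sum>i\<in>I. \<beta> i * ?y i) + t\<^sup>2 * C"
      by (simp add: \<Psi>_def \<beta>_def C_def sum.distrib sum_subtractf sum_distrib_left)
    finally have "t * (2 * (\<Sum>i\<in>I. \<beta> i * ?y i)) \<le> t * (e\<^sup>2 / 4 + t * C)"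
      by (simp add: power2_eq_square algebra_simps)
    then have "2 * (\<Sum>i\<in>I. \<beta> i * ?y i) \<le> e\<^sup>2 / 4 + t * C" using t(1) by (simp only: mult_le_cancel_left_pos)
    then have "(\<Sum>i\<in>I. \<beta> i * ?y i) \<le> e\<^sup>2 / 4" using t(3) by simp
    moreover have "(\<Sum>i\<in>I. \<beta> i * ?y i) = (\<Sum>i\<in>I. \<beta> i * g i) - (b * A - \<Psi> h)"
    proof -
      have "\<beta> i * h i = b * \<beta> i - (\<beta> i)\<^sup>2" for i
        by (auto simp: \<beta>_def max_def power2_eq_square algebra_simps)
      then have "(\<Sum>i\<in>I. \<beta> i * h i) = b * A - \<Psi> h"
        by (simp add: \<Psi>_def A_def sum_subtractf sum_distrib_left flip: \<beta>_def)
      then show ?thesis by (simp add: right_diff_distrib sum_subtractf)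
    qed
    ultimately show ?thesis using \<Psi>_ge[OF h(1)] by simp
  qed
  show ?thesis
  proof
    show "0 \<le> \<beta> i / A" for i using A by (simp add: \<beta>_def)
    show "(\<Sum>i\<in>I. \<beta> i / A) = 1" using A by (simp add: A_def flip: sum_divide_distrib)
    show "b - 3 / 4 * e\<^sup>2 / A < b" using A e by simp
    show "(\<Sum>i\<in>I. \<beta> i / A * g i) \<le> b - 3 / 4 * e\<^sup>2 / A" if "g \<in> \<H>" for g
      using divide_right_mono[OF main[OF that], of A] A by (simp add: sum_divide_distrib diff_divide_distrib)
  qed
qed

section \<open>Quadratic norms from the von Neumann inequality\<close>

definition polydisc :: "(nat \<Rightarrow> complex) set" where
  "polydisc = {z. \<forall>i. cmod (z i) \<le> 1}"

text \<open>
  For a probability measure on the polydisc the functional \<open>p \<mapsto> \<integral> \<bar>p\<bar>\<^sup>2\<close> has these properties. They are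
  preserved by convex combinations and pointwise limits, so the functionals
  form a convex set that is compact by Tychonoff's theorem, and no measure has to be constructed.
\<close>
definition square_means :: "(cpoly \<Rightarrow> real) set" where
  "square_means = {\<Phi>. (\<forall>p. \<Phi> p \<in> {0..(coeff_norm p)\<^sup>2})
     \<and> (\<forall>c p. \<Phi> (const c * p) = (cmod c)\<^sup>2 * \<Phi> p)
     \<and> (\<forall>p q. \<Phi> (p + q) + \<Phi> (p - q) = 2 * \<Phi> p + 2 * \<Phi> q)
     \<and> (\<forall>i p. \<Phi> (var i * p) \<le> \<Phi> p)}"

lemma point_evaluation_square_mean:
  assumes z: "z \<in> polydisc"
  shows "(\<lambda>p. (cmod (eval_poly id z p))\<^sup>2) \<in> square_means"
  unfolding square_means_def mem_Collect_eq
proof (intro conjI allI)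
  fix p q c i
  obtain n where "in_variables n p" using in_variables_exists by blast
  with z have "cmod (eval_poly id z p) \<le> coeff_norm p"
    by (intro cmod_eval_le_coeff_norm) (auto simp: polydisc_def)
  then show "(cmod (eval_poly id z p))\<^sup>2 \<in> {0..(coeff_norm p)\<^sup>2}" by (simp add: power_mono)
  show "(cmod (eval_poly id z (const c * p)))\<^sup>2 = (cmod c)\<^sup>2 * (cmod (eval_poly id z p))\<^sup>2"
    by (simp add: eval_id norm_mult power_mult_distrib)
  show "(cmod (eval_poly id z (p + q)))\<^sup>2 + (cmod (eval_poly id z (p - q)))\<^sup>2
      = 2 * (cmod (eval_poly id z p))\<^sup>2 + 2 * (cmod (eval_poly id z q))\<^sup>2"
    by (simp add: eval_id cmod_power2) (simp add: power2_eq_square algebra_simps)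
  have "(cmod (z i))\<^sup>2 \<le> 1" using z by (simp add: polydisc_def power_le_one)
  then show "(cmod (eval_poly id z (var i * p)))\<^sup>2 \<le> (cmod (eval_poly id z p))\<^sup>2"
    by (simp add: eval_id norm_mult power_mult_distrib mult_left_le_one_le)
qed

lemma square_means_convex:
  assumes "\<Phi> \<in> square_means" "\<Psi> \<in> square_means" "0 \<le> t" "t \<le> 1"
  shows "(\<lambda>p. (1 - t) * \<Phi> p + t * \<Psi> p) \<in> square_means"
  unfolding square_means_def mem_Collect_eq
proof (intro conjI allI)
  fix p q c i
  have 1: "0 \<le> \<Phi> p" "0 \<le> \<Psi> p" "\<Phi> p \<le> (coeff_norm p)\<^sup>2" "\<Psi> p \<le> (coeff_norm p)\<^sup>2"
    "\<Phi> (const c * p) = (cmod c)\<^sup>2 * \<Phi> p" "\<Psi> (const c * p) = (cmod c)\<^sup>2 * \<Psi> p"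
    "\<Phi> (p + q) + \<Phi> (p - q) = 2 * \<Phi> p + 2 * \<Phi> q" "\<Psi> (p + q) + \<Psi> (p - q) = 2 * \<Psi> p + 2 * \<Psi> q"
    "\<Phi> (var i * p) \<le> \<Phi> p" "\<Psi> (var i * p) \<le> \<Psi> p"
    using assms(1,2) by (simp_all add: square_means_def)
  have "(1 - t) * \<Phi> p + t * \<Psi> p \<le> (1 - t) * (coeff_norm p)\<^sup>2 + t * (coeff_norm p)\<^sup>2"
    using 1 assms(3,4) by (intro add_mono mult_left_mono) auto
  also have "\<dots> = (coeff_norm p)\<^sup>2" by (simp add: algebra_simps)
  finally show "(1 - t) * \<Phi> p + t * \<Psi> p \<in> {0..(coeff_norm p)\<^sup>2}"
    using 1 assms(3,4) by simp
  show "(1 - t) * \<Phi> (const c * p) + t * \<Psi> (const c * p) = (cmod c)\<^sup>2 * ((1 - t) * \<Phi> p + t * \<Psi> p)"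
    unfolding 1 by (simp add: algebra_simps)
  have "(1 - t) * \<Phi> (p + q) + t * \<Psi> (p + q) + ((1 - t) * \<Phi> (p - q) + t * \<Psi> (p - q))
      = (1 - t) * (\<Phi> (p + q) + \<Phi> (p - q)) + t * (\<Psi> (p + q) + \<Psi> (p - q))"
    by (simp add: algebra_simps)
  also have "\<dots> = 2 * ((1 - t) * \<Phi> p + t * \<Psi> p) + 2 * ((1 - t) * \<Phi> q + t * \<Psi> q)"
    unfolding 1 by (simp add: algebra_simps)
  finally show "(1 - t) * \<Phi> (p + q) + t * \<Psi> (p + q) + ((1 - t) * \<Phi> (p - q) + t * \<Psi> (p - q))
      = 2 * ((1 - t) * \<Phi> p + t * \<Psi> p) + 2 * ((1 - t) * \<Phi> q + t * \<Psi> q)" .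
  show "(1 - t) * \<Phi> (var i * p) + t * \<Psi> (var i * p) \<le> (1 - t) * \<Phi> p + t * \<Psi> p"
    using 1 assms(3,4) by (intro add_mono mult_left_mono) auto
qed

lemma compact_square_means: "compact square_means"
proof -
  define B where "B = {\<Phi>. (\<forall>c p. \<Phi> (const c * p) = (cmod c)\<^sup>2 * \<Phi> p)
     \<and> (\<forall>p q. \<Phi> (p + q) + \<Phi> (p - q) = 2 * \<Phi> p + 2 * \<Phi> q)
     \<and> (\<forall>i p. \<Phi> (var i * p) \<le> \<Phi> p)}"
  have "closed B"
    unfolding B_def
    by (intro closed_Collect_conj closed_Collect_all closed_Collect_eq closed_Collect_le
        continuous_on_add continuous_on_mult continuous_on_const continuous_on_product_coordinates)
  moreover have "compact (PiE UNIV (\<lambda>p. {0..(coeff_norm p)\<^sup>2}))"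
    using compactin_PiE[of "\<lambda>p::cpoly. euclidean :: real topology" UNIV "\<lambda>p. {0..(coeff_norm p)\<^sup>2}"]
    by (simp add: euclidean_product_topology)
  moreover have "square_means = PiE UNIV (\<lambda>p. {0..(coeff_norm p)\<^sup>2}) \<inter> B"
    by (auto simp: square_means_def B_def PiE_UNIV_domain)
  ultimately show ?thesis using compact_Int_closed by metis
qed

lemma cmod_convex_combination_le:
  assumes "\<And>i. i \<in> I \<Longrightarrow> 0 \<le> \<alpha> i" "(\<Sum>i\<in>I. \<alpha> i) = 1"
  shows "(cmod (\<Sum>i\<in>I. complex_of_real (\<alpha> i) * w i))\<^sup>2 \<le> (\<Sum>i\<in>I. \<alpha> i * (cmod (w i))\<^sup>2)"
proof -
  have "cmod (\<Sum>i\<in>I. complex_of_real (\<alpha> i) * w i) \<le> (\<Sum>i\<in>I. sqrt (\<alpha> i) * (sqrt (\<alpha> i) * cmod (w i)))"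
    using assms(1) by (intro sum_norm_le) (simp add: norm_mult flip: mult.assoc)
  then have "(cmod (\<Sum>i\<in>I. complex_of_real (\<alpha> i) * w i))\<^sup>2 \<le> (\<Sum>i\<in>I. sqrt (\<alpha> i) * (sqrt (\<alpha> i) * cmod (w i)))\<^sup>2"
    by (rule power_mono) simp
  also have "\<dots> \<le> (\<Sum>i\<in>I. (sqrt (\<alpha> i))\<^sup>2) * (\<Sum>i\<in>I. (sqrt (\<alpha> i) * cmod (w i))\<^sup>2)"
    by (rule Cauchy_Schwarz_ineq_sum)
  also have "(\<Sum>i\<in>I. (sqrt (\<alpha> i))\<^sup>2) = 1" using assms by (simp cong: sum.cong)
  also have "(\<Sum>i\<in>I. (sqrt (\<alpha> i) * cmod (w i))\<^sup>2) = (\<Sum>i\<in>I. \<alpha> i * (cmod (w i))\<^sup>2)"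
    using assms(1) by (simp add: power_mult_distrib cong: sum.cong)
  finally show ?thesis by simp
qed

locale von_neumann_generators =
  fixes N :: "complex ^ 'k \<Rightarrow> real" and a :: "nat \<Rightarrow> complex ^ 'k"
  assumes norm: "banach_algebra_norm N" and vN: "von_neumann_inequality N"
    and a_ball: "\<And>i. N (a i) \<le> 1"
    and a_dense: "{v. N v \<le> 1} \<subseteq> closure (range a)"
begin

lemma N_nonneg: "0 \<le> N v" and N_eq_0: "N v = 0 \<longleftrightarrow> v = 0" and N_scale: "N (c *s v) = cmod c * N v"
  and N_triangle: "N (v + w) \<le> N v + N w" and N_mult: "N (v * w) \<le> N v * N w"
  using norm by (simp_all add: banach_algebra_norm_def)

text \<open>
  By compactness it suffices to treat finitely many \<open>p\<close> with \<open>p(a) = f\<close> and an \<open>e > 0\<close>. If no square mean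
  exceeds \<open>(N f)\<^sup>2 - e\<close> on all of them, then the minimax principle, applied to point evaluations, yields a
  convex combination \<open>q\<close> of the given polynomials with \<open>\<bar>q\<bar>\<^sup>2 \<le> s < (N f)\<^sup>2\<close> on the polydisc. But
  \<open>q(a) = f\<close>, against the von Neumann inequality.
\<close>
lemma separating_square_mean:
  "\<exists>\<Phi>\<in>square_means. \<forall>p. eval_poly vec a p = f \<longrightarrow> (N f)\<^sup>2 \<le> \<Phi> p"
proof -
  define I where "I = {p. eval_poly vec a p = f} \<times> {e::real. 0 < e}"
  define F where "F = (\<lambda>(p, e). {\<Phi> :: cpoly \<Rightarrow> real. (N f)\<^sup>2 - e \<le> \<Phi> p})"
  have "square_means \<inter> (\<Inter>i\<in>I. F i) \<noteq> {}"
  proof (rule compact_imp_fip_image[OF compact_square_means])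
    show "closed (F i)" for i
      by (cases i) (auto simp: F_def intro!: closed_Collect_le continuous_on_const continuous_on_product_coordinates)
  next
    fix I' assume I': "finite I'" "I' \<subseteq> I"
    define P where "P = fst ` I'"
    define e where "e = Min (insert 1 (snd ` I'))"
    have fin: "finite P" using I'(1) by (simp add: P_def)
    have e: "0 < e" using I' by (auto simp: e_def I_def)
    have e_le: "e \<le> e'" if "(p, e') \<in> I'" for p e'
      unfolding e_def using I'(1) that by (intro Min_le) force+
    have P: "eval_poly vec a p = f" if "p \<in> P" for p using that I'(2) by (auto simp: P_def I_def)
    show "square_means \<inter> (\<Inter>i\<in>I'. F i) \<noteq> {}"
    proof (rule ccontr)
      assume empty: "\<not> square_means \<inter> (\<Inter>i\<in>I'. F i) \<noteq> {}"
      have below: "\<exists>p\<in>P. \<Phi> p < (N f)\<^sup>2 - e" if "\<Phi> \<in> square_means" for \<Phi>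
      proof -
        have "\<Phi> \<notin> (\<Inter>i\<in>I'. F i)" using empty that by blast
        then obtain i where i: "i \<in> I'" "\<Phi> \<notin> F i" by blast
        obtain p e' where pe: "i = (p, e')" by (cases i)
        have "\<Phi> p < (N f)\<^sup>2 - e'" "p \<in> P" using i by (force simp: F_def P_def pe)+
        with e_le[of p e'] i(1) show ?thesis by (intro bexI[of _ p]) (auto simp: pe)
      qed
      have zero_in: "(\<lambda>i. 0) \<in> polydisc" by (simp add: polydisc_def)
      have bdd: "\<bar>\<Phi> p\<bar> \<le> (\<Sum>p\<in>P. (coeff_norm p)\<^sup>2)" if "\<Phi> \<in> square_means" "p \<in> P" for \<Phi> p
      proof -
        have "\<bar>\<Phi> p\<bar> \<le> (coeff_norm p)\<^sup>2" using that(1) by (simp add: square_means_def)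
        also have "\<dots> \<le> (\<Sum>p\<in>P. (coeff_norm p)\<^sup>2)" using fin that(2) by (intro member_le_sum) auto
        finally show ?thesis .
      qed
      have ne: "square_means \<noteq> {}" using point_evaluation_square_mean[OF zero_in] by blast
      obtain \<alpha> s where \<alpha>: "\<And>p. p \<in> P \<Longrightarrow> 0 \<le> \<alpha> p" "(\<Sum>p\<in>P. \<alpha> p) = 1" and s: "s < (N f)\<^sup>2"
        and le: "\<And>\<Phi>. \<Phi> \<in> square_means \<Longrightarrow> (\<Sum>p\<in>P. \<alpha> p * \<Phi> p) \<le> s"
      proof (rule finite_minimax[of P square_means "\<Sum>p\<in>P. (coeff_norm p)\<^sup>2" e "(N f)\<^sup>2"])
        note obtained = that
        show "(\<lambda>p. (1 - t) * \<Phi> p + t * \<Psi> p) \<in> square_means"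
          if "\<Phi> \<in> square_means" "\<Psi> \<in> square_means" "0 \<le> t" "t \<le> 1" for \<Phi> \<Psi> t
          using that by (rule square_means_convex)
        show thesis if "\<And>p. p \<in> P \<Longrightarrow> 0 \<le> \<alpha> p" "(\<Sum>p\<in>P. \<alpha> p) = 1" "s < (N f)\<^sup>2"
          "\<And>\<Phi>. \<Phi> \<in> square_means \<Longrightarrow> (\<Sum>p\<in>P. \<alpha> p * \<Phi> p) \<le> s" for \<alpha> s
          by (rule obtained) (fact that)+
      qed (use fin ne bdd e below in simp_all)
      define q where "q = (\<Sum>p\<in>P. const (complex_of_real (\<alpha> p)) * p)"
      have "eval_poly vec a q = (\<Sum>p\<in>P. complex_of_real (\<alpha> p) *s f)"
        by (simp add: q_def eval_vec P cong: sum.cong)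
      also have "\<dots> = (\<Sum>p\<in>P. complex_of_real (\<alpha> p)) *s f" by (simp add: vec_eq_iff sum_distrib_right)
      also have "(\<Sum>p\<in>P. complex_of_real (\<alpha> p)) = 1" by (simp only: \<alpha>(2) of_real_1 flip: of_real_sum)
      finally have q: "eval_poly vec a q = f" by simp
      have small: "(cmod (eval_poly id z q))\<^sup>2 \<le> s" if z: "z \<in> polydisc" for z
      proof -
        have "(cmod (eval_poly id z q))\<^sup>2 \<le> (\<Sum>p\<in>P. \<alpha> p * (cmod (eval_poly id z p))\<^sup>2)"
          unfolding q_def eval_id id_apply by (rule cmod_convex_combination_le[OF \<alpha>])
        then show ?thesis using le[OF point_evaluation_square_mean[OF z]] by simp
      qed
      have s0: "0 \<le> s" using small[OF zero_in] by (meson order.trans zero_le_power2)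
      obtain n where n: "in_variables n q" using in_variables_exists by blast
      have "N f \<le> polydisc_sup n q"
        using vN n a_ball q unfolding von_neumann_inequality_def norm_ball_def by force
      also have "\<dots> \<le> sqrt s"
        unfolding polydisc_sup_def
      proof (rule cSUP_least)
        show "{z. \<forall>i<n. cmod (z i) \<le> 1} \<noteq> {}" by (auto intro: exI[of _ "\<lambda>i. 0"])
        fix z :: "nat \<Rightarrow> complex" assume z: "z \<in> {z. \<forall>i<n. cmod (z i) \<le> 1}"
        have "eval_poly id z q = eval_poly id (\<lambda>i. if i < n then z i else 0) q"
          by (rule eval_poly_cong_variables[OF n]) simp
        moreover have "(\<lambda>i. if i < n then z i else 0) \<in> polydisc" using z by (simp add: polydisc_def)
        ultimately show "cmod (eval_poly id z q) \<le> sqrt s" using small by (simp add: real_le_rsqrt)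
      qed
      finally have "(N f)\<^sup>2 \<le> s" using s0 N_nonneg[of f] by (metis power_mono real_sqrt_pow2)
      with s show False by simp
    qed
  qed
  then obtain \<Phi> where \<Phi>: "\<Phi> \<in> square_means" "\<And>i. i \<in> I \<Longrightarrow> \<Phi> \<in> F i" by blast
  have "(N f)\<^sup>2 \<le> \<Phi> p" if "eval_poly vec a p = f" for p
  proof (rule field_le_epsilon)
    fix e :: real assume "0 < e"
    then show "(N f)\<^sup>2 \<le> \<Phi> p + e" using \<Phi>(2)[of "(p, e)"] that by (simp add: I_def F_def)
  qed
  with \<Phi>(1) show ?thesis by blast
qed

text \<open>
  The values \<open>p(a)\<close> form a subspace. Subspaces of \<open>\<complex>\<^sup>k\<close> are closed, and this one is dense in the ball.
\<close>
lemma eval_surj: "\<exists>p. eval_poly vec a p = v"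
proof -
  let ?R = "range (eval_poly vec a)"
  have scale: "c *s v \<in> ?R" if v: "v \<in> ?R" for c v
  proof -
    obtain p where "v = eval_poly vec a p" using v by blast
    then have "c *s v = eval_poly vec a (const c * p)" by (simp add: eval_vec)
    then show ?thesis by blast
  qed
  have "subspace ?R"
    unfolding subspace_def
  proof (intro conjI ballI allI)
    show "0 \<in> ?R" using scale[of _ 0] by (auto simp: eval_poly_def intro!: image_eqI[of _ _ 0])
    show "x + y \<in> ?R" if "x \<in> ?R" "y \<in> ?R" for x y
      using that by (auto simp: image_iff) (metis eval_vec(1))
    show "r *\<^sub>R x \<in> ?R" if "x \<in> ?R" for r x
    proof -
      have "r *\<^sub>R x = complex_of_real r *s x"
        unfolding vec_eq_iff vector_scaleR_component vector_smult_component
        by (simp add: scaleR_conv_of_real)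
      then show ?thesis using scale[OF that] by simp
    qed
  qed
  then have "closed ?R" by (rule closed_subspace)
  moreover have "range a \<subseteq> ?R"
    using eval_vec(7) by (metis image_subset_iff rangeI)
  ultimately have ball: "{v. N v \<le> 1} \<subseteq> ?R"
    using a_dense closure_minimal by blast
  show ?thesis
  proof (cases "v = 0")
    case True
    then have "N v \<le> 1" using N_eq_0[of v] by simp
    with ball have "v \<in> ?R" by blast
    then show ?thesis by auto
  next
    case False
    then have "N v \<noteq> 0" by (simp add: N_eq_0)
    then have "N (complex_of_real (1 / N v) *s v) = 1" by (simp add: N_scale N_nonneg norm_divide)
    then have "complex_of_real (1 / N v) *s v \<in> ?R" using ball by auto
    from scale[OF this, of "complex_of_real (N v)"] \<open>N v \<noteq> 0\<close> show ?thesis by auto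
  qed
qed

text \<open>
  \<open>Q\<close> is the quotient of the square mean along \<open>p \<mapsto> p(a)\<close>. Multiplication by \<open>a i\<close> lifts to
  multiplication by a variable, hence is contractive; continuity of \<open>Q\<close> and density of
  the \<open>a i\<close> extend this to the whole ball.
\<close>
lemma exists_contractive_form:
  obtains Q where "quadratic_seminorm Q" "\<And>w v. sqrt (Q (w * v)) \<le> N w * sqrt (Q v)"
    "Q 1 \<le> 1" "(N f)\<^sup>2 \<le> Q f"
proof -
  obtain \<Phi> where \<Phi>: "\<Phi> \<in> square_means" and sep: "\<And>p. eval_poly vec a p = f \<Longrightarrow> (N f)\<^sup>2 \<le> \<Phi> p"
    using separating_square_mean by blast
  have \<Phi>_nonneg: "0 \<le> \<Phi> p" and \<Phi>_le: "\<Phi> p \<le> (coeff_norm p)\<^sup>2"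
    and \<Phi>_scale: "\<Phi> (const c * p) = (cmod c)\<^sup>2 * \<Phi> p"
    and \<Phi>_par: "\<Phi> (p + q) + \<Phi> (p - q) = 2 * \<Phi> p + 2 * \<Phi> q"
    and \<Phi>_var: "\<Phi> (var i * p) \<le> \<Phi> p" for c p q i
    using \<Phi> by (simp_all add: square_means_def)
  define Q where "Q v = (INF p\<in>{p. eval_poly vec a p = v}. \<Phi> p)" for v
  have Q_le: "Q v \<le> \<Phi> p" if "eval_poly vec a p = v" for v p
    unfolding Q_def using that \<Phi>_nonneg by (intro cINF_lower bdd_belowI2[where m = 0]) auto
  have Q_ge: "c \<le> Q v" if "\<And>p. eval_poly vec a p = v \<Longrightarrow> c \<le> \<Phi> p" for c v
    unfolding Q_def using that eval_surj[of v] by (intro cINF_greatest) auto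
  have Q_approx: "\<exists>p. eval_poly vec a p = v \<and> \<Phi> p < Q v + e" if "0 < e" for v e
    using Q_ge[of v "Q v + e"] that by force
  have scale_le: "Q (c *s v) \<le> (cmod c)\<^sup>2 * Q v" for c v
  proof (rule field_le_epsilon)
    fix e :: real assume e: "0 < e"
    define d where "d = e / ((cmod c)\<^sup>2 + 1)"
    have d: "0 < d" "(cmod c)\<^sup>2 * d \<le> e"
      using e by (simp_all add: d_def divide_simps add_nonneg_pos)
    obtain p where p: "eval_poly vec a p = v" "\<Phi> p < Q v + d" using Q_approx[OF d(1)] by blast
    have "Q (c *s v) \<le> \<Phi> (const c * p)" by (rule Q_le) (simp add: eval_vec p)
    also have "\<dots> \<le> (cmod c)\<^sup>2 * (Q v + d)" using p(2) by (simp add: \<Phi>_scale mult_left_mono)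
    also have "\<dots> \<le> (cmod c)\<^sup>2 * Q v + e" using d(2) by (simp add: algebra_simps)
    finally show "Q (c *s v) \<le> (cmod c)\<^sup>2 * Q v + e" .
  qed
  have scale: "Q (c *s v) = (cmod c)\<^sup>2 * Q v" for c v
  proof (cases "c = 0")
    case True
    then show ?thesis using scale_le[of 0 v] Q_ge[OF \<Phi>_nonneg, of "0 *s v"] by simp
  next
    case False
    have "Q (inverse c *s (c *s v)) \<le> (cmod (inverse c))\<^sup>2 * Q (c *s v)" by (rule scale_le)
    then have "Q v \<le> (inverse (cmod c))\<^sup>2 * Q (c *s v)"
      using False by (simp add: norm_inverse)
    then have "(cmod c)\<^sup>2 * Q v \<le> (cmod c)\<^sup>2 * ((inverse (cmod c))\<^sup>2 * Q (c *s v))"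
      by (rule mult_left_mono) simp
    also have "\<dots> = Q (c *s v)"
      using False by (simp add: power_inverse flip: mult.assoc)
    finally have "(cmod c)\<^sup>2 * Q v \<le> Q (c *s v)" .
    with scale_le[of c v] show ?thesis by simp
  qed
  have par_le: "Q (v + w) + Q (v - w) \<le> 2 * Q v + 2 * Q w" for v w
  proof (rule field_le_epsilon)
    fix e :: real assume e: "0 < e"
    obtain p where p: "eval_poly vec a p = v" "\<Phi> p < Q v + e / 4" using Q_approx[of "e / 4"] e by auto
    obtain q where q: "eval_poly vec a q = w" "\<Phi> q < Q w + e / 4" using Q_approx[of "e / 4"] e by auto
    have "Q (v + w) + Q (v - w) \<le> \<Phi> (p + q) + \<Phi> (p - q)"
      by (intro add_mono Q_le) (simp_all add: eval_vec p q)
    then show "Q (v + w) + Q (v - w) \<le> 2 * Q v + 2 * Q w + e" using p(2) q(2) by (simp add: \<Phi>_par)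
  qed
  have qs: "quadratic_seminorm Q"
  proof
    fix v w :: "complex ^ 'k"
    show "0 \<le> Q v" by (rule Q_ge) (rule \<Phi>_nonneg)
    have "(v + w) + (v - w) = 2 *s v" "(v + w) - (v - w) = 2 *s w" by (simp_all add: vec_eq_iff)
    then have "2 * Q v + 2 * Q w \<le> Q (v + w) + Q (v - w)"
      using par_le[of "v + w" "v - w"] by (simp add: scale)
    with par_le[of v w] show "Q (v + w) + Q (v - w) = 2 * Q v + 2 * Q w" by simp
  qed (rule scale)
  interpret Q: quadratic_seminorm Q by (rule qs)
  have gen: "Q (a i * v) \<le> Q v" for i v
    by (rule Q_ge) (use Q_le[of "var i * _" "a i * v"] \<Phi>_var[of i] in \<open>force simp: eval_vec intro: order.trans\<close>)
  have ball: "Q (w * v) \<le> Q v" if w: "N w \<le> 1" for w v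
  proof -
    have "w \<in> closure (range a)" using a_dense w by blast
    then obtain x where x: "\<And>n. x n \<in> range a" "x \<longlonglongrightarrow> w" by (auto simp: closure_sequential)
    have "(\<lambda>n. x n * v) \<longlonglongrightarrow> w * v"
      by (rule vec_tendstoI) (simp add: tendsto_mult_right tendsto_vec_nth[OF x(2)])
    then have "(\<lambda>n. Q (x n * v)) \<longlonglongrightarrow> Q (w * v)" by (rule Q.tendsto)
    moreover have "Q (x n * v) \<le> Q v" for n using x(1)[of n] gen by auto
    ultimately show ?thesis by (intro LIMSEQ_le_const2) auto
  qed
  show ?thesis
  proof
    show "quadratic_seminorm Q" by (rule qs)
    show "(N f)\<^sup>2 \<le> Q f" by (rule Q_ge) (rule sep)
    have "coeff_norm 1 = 1" by (simp add: coeff_norm_def)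
    then show "Q 1 \<le> 1" using Q_le[OF eval_vec(5)] \<Phi>_le[of 1] by simp
    show "sqrt (Q (w * v)) \<le> N w * sqrt (Q v)" for w v
    proof (cases "w = 0")
      case True
      then show ?thesis by (simp add: N_nonneg Q.nonneg)
    next
      case False
      then have Nw: "0 < N w" using N_eq_0[of w] N_nonneg[of w] by simp
      define u where "u = complex_of_real (1 / N w) *s w"
      have w: "w = complex_of_real (N w) *s u" using Nw by (simp add: u_def)
      have "N u = 1" using Nw by (simp add: u_def N_scale norm_divide)
      then have "sqrt (Q (u * v)) \<le> sqrt (Q v)" by (simp add: ball)
      moreover have "sqrt (Q (w * v)) = N w * sqrt (Q (u * v))"
        by (subst w) (use Nw in \<open>simp add: vec_scale_mult Q.sqrt_scale\<close>)
      ultimately show ?thesis using Nw by simp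
    qed
  qed
qed

end

context von_neumann_generators
begin

lemma cmod_component_le: "cmod (w $ x) \<le> N w"
proof -
  have "axis x (1::complex) \<noteq> 0" by (simp add: axis_eq_0_iff)
  then have pos: "0 < N (axis x 1)" using N_eq_0 N_nonneg[of "axis x 1"] by (simp add: less_le)
  have "w * axis x 1 = (w $ x) *s axis x 1" by (auto simp: vec_eq_iff axis_def)
  then have "cmod (w $ x) * N (axis x 1) \<le> N w * N (axis x 1)"
    using N_mult[of w "axis x 1"] by (simp add: N_scale)
  then show ?thesis using pos by simp
qed

definition mean_square :: "complex ^ 'k \<Rightarrow> real" where
  "mean_square v = (norm v)\<^sup>2 / real CARD('k)"

lemma norm_sq_sum: "(norm v)\<^sup>2 = (\<Sum>x\<in>UNIV. (cmod (v $ x))\<^sup>2)" for v :: "complex ^ 'k"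
  by (simp add: norm_vec_def L2_set_def sum_nonneg)

lemma quadratic_seminorm_mean_square: "quadratic_seminorm mean_square"
proof -
  have "quadratic_seminorm (\<lambda>v :: complex ^ 'k. (1 / real CARD('k)) * (\<Sum>x\<in>UNIV. (cmod (v $ x))\<^sup>2))"
    by (intro quadratic_seminorm_mult quadratic_seminorm_sum quadratic_seminorm_linear) simp_all
  moreover have "mean_square = (\<lambda>v. (1 / real CARD('k)) * (\<Sum>x\<in>UNIV. (cmod (v $ x))\<^sup>2))"
    by (simp add: fun_eq_iff mean_square_def norm_sq_sum)
  ultimately show ?thesis by simp
qed

lemma mean_square_mult_le: "mean_square (w * v) \<le> (N w)\<^sup>2 * mean_square v"
proof -
  have "(norm (w * v))\<^sup>2 \<le> (N w)\<^sup>2 * (norm v)\<^sup>2"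
    unfolding norm_sq_sum sum_distrib_left
  proof (rule sum_mono)
    fix x
    have "(cmod (w $ x))\<^sup>2 \<le> (N w)\<^sup>2" using cmod_component_le by (intro power_mono) auto
    then show "(cmod ((w * v) $ x))\<^sup>2 \<le> (N w)\<^sup>2 * (cmod (v $ x))\<^sup>2"
      by (simp add: norm_mult power_mult_distrib mult_right_mono)
  qed
  then show ?thesis by (simp add: mean_square_def divide_right_mono)
qed

text \<open>
  The mean of \<open>\<bar>v $ x\<bar>\<^sup>2\<close> over the coordinates is definite and satisfies the same bounds, since the
  coordinates are characters and \<open>\<bar>w $ x\<bar> \<le> N w\<close>. Mixing it in with weight \<open>d\<close> costs only the
  factor \<open>1 - d\<close> in the lower bound.
\<close>
lemma exists_definite_contractive_form:
  assumes d: "0 < d" "d < 1"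
  obtains Q where "quadratic_norm Q" "\<And>w v. sqrt (Q (w * v)) \<le> N w * sqrt (Q v)"
    "Q 1 \<le> 1" "(1 - d) * (N f)\<^sup>2 \<le> Q f"
proof -
  obtain Q where Q: "quadratic_seminorm Q" "\<And>w v. sqrt (Q (w * v)) \<le> N w * sqrt (Q v)"
    "Q 1 \<le> 1" "(N f)\<^sup>2 \<le> Q f"
    using exists_contractive_form by blast
  interpret Q: quadratic_seminorm Q by (rule Q(1))
  interpret M: quadratic_seminorm mean_square by (rule quadratic_seminorm_mean_square)
  define P where "P v = (1 - d) * Q v + d * mean_square v" for v
  have P: "quadratic_seminorm P"
    unfolding P_def using d
    by (intro quadratic_seminorm_add quadratic_seminorm_mult Q(1) quadratic_seminorm_mean_square) auto
  show ?thesis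
  proof
    show "(1 - d) * (N f)\<^sup>2 \<le> P f"
      using mult_left_mono[OF Q(4), of "1 - d"] mult_nonneg_nonneg[OF less_imp_le[OF d(1)] M.nonneg[of f]] d(2)
      unfolding P_def by linarith
    have "mean_square 1 = 1" by (simp add: mean_square_def norm_sq_sum)
    moreover have "(1 - d) * Q 1 \<le> (1 - d) * 1" using d Q(3) by (intro mult_left_mono) auto
    ultimately show "P 1 \<le> 1" by (simp add: P_def)
    show "sqrt (P (w * v)) \<le> N w * sqrt (P v)" for w v
    proof -
      have "Q (w * v) \<le> (N w)\<^sup>2 * Q v"
      proof -
        have "(sqrt (Q (w * v)))\<^sup>2 \<le> (N w * sqrt (Q v))\<^sup>2" by (intro power_mono Q(2)) (simp add: Q.nonneg)
        then show ?thesis by (simp add: power_mult_distrib Q.nonneg)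
      qed
      then have "P (w * v) \<le> (1 - d) * ((N w)\<^sup>2 * Q v) + d * ((N w)\<^sup>2 * mean_square v)"
        unfolding P_def using d by (intro add_mono mult_left_mono mean_square_mult_le) auto
      also have "\<dots> = (N w)\<^sup>2 * P v" by (simp add: P_def algebra_simps)
      finally have "sqrt (P (w * v)) \<le> sqrt ((N w)\<^sup>2 * P v)" by simp
      then show ?thesis by (simp add: real_sqrt_mult N_nonneg)
    qed
    have "sqrt (d / real CARD('k)) * norm v \<le> sqrt (P v)" for v
    proof -
      have "d / real CARD('k) * (norm v)\<^sup>2 \<le> P v"
        using d Q.nonneg[of v] by (simp add: P_def mean_square_def)
      then have "sqrt (d / real CARD('k) * (norm v)\<^sup>2) \<le> sqrt (P v)" by simp
      then show ?thesis by (simp only: real_sqrt_mult real_sqrt_abs abs_norm_cancel)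
    qed
    then show "quadratic_norm P"
      using d by (intro quadratic_norm.intro P quadratic_norm_axioms.intro exI[of _ "sqrt (d / real CARD('k))"]) simp
  qed
qed

end

text \<open>
  The summands are indexed by pairs \<open>(i, j)\<close>: the form for the index \<open>(i, j)\<close> nearly attains the norm of the
  dense element \<open>a i\<close>, up to the factor \<open>1 - d j\<close> with \<open>d j\<close> tending to \<open>0\<close>. All norms are tested on
  the vector \<open>1\<close>.
\<close>
lemma von_neumann_ball_in_operator_algebra_balls:
  fixes N :: "complex ^ 'k \<Rightarrow> real"
  assumes card: "(UNIV :: (nat \<Rightarrow> complex) set) \<lesssim> (UNIV :: 'h set)"
    and N: "banach_algebra_norm N" and vN: "von_neumann_inequality N"
  shows "norm_ball N \<in> operator_algebra_balls TYPE('h)"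
proof -
  obtain T where T: "countable T" "T \<subseteq> {v. N v \<le> 1}" "{v. N v \<le> 1} \<subseteq> closure T"
    using separable by blast
  have N0: "N 0 = 0" using N by (simp add: banach_algebra_norm_def)
  then have "0 \<in> closure T" using T(3) by (auto intro: subsetD)
  then have "T \<noteq> {}" by auto
  define a where "a = from_nat_into T"
  have range_a: "range a = T" using T(1) \<open>T \<noteq> {}\<close> by (simp add: a_def)
  interpret von_neumann_generators N a
    by (rule von_neumann_generators.intro) (use N vN T range_a in auto)
  define d where "d j = 1 / (real j + 2)" for j
  have d: "0 < d j" "d j < 1" for j by (simp_all add: d_def)
  define good where "good i j Q \<longleftrightarrow> quadratic_norm Q \<and> (\<forall>w v. sqrt (Q (w * v)) \<le> N w * sqrt (Q v)) \<and>
    Q 1 \<le> 1 \<and> (1 - d j) * (N (a i))\<^sup>2 \<le> Q (a i)" for i j Q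
  have "\<exists>Q. good i j Q" for i j
    unfolding good_def by (rule exists_definite_contractive_form[OF d, of j "a i"]) blast
  then obtain R where R: "\<And>i j. good i j (R i j)" by metis
  define Q where "Q m = R (fst (prod_decode m)) (snd (prod_decode m))" for m
  have Q: "good (fst (prod_decode m)) (snd (prod_decode m)) (Q m)" for m
    unfolding Q_def by (rule R)
  obtain C where C: "0 \<le> C" "\<And>v. N v \<le> C * norm v"
    using seminorm_le_euclidean[OF N_scale N_triangle] by blast
  show ?thesis
  proof (rule in_operator_algebra_balls[OF card N])
    show "quadratic_norm (Q m)" "sqrt (Q m (w * v)) \<le> N w * sqrt (Q m v)" for m w v
      using Q[of m] by (simp_all add: good_def)
    fix w and e :: real assume e: "0 < e"
    show "\<exists>m v. Q m v \<le> 1 \<and> N w - e \<le> sqrt (Q m (w * v))"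
    proof (cases "w = 0")
      case True
      then show ?thesis using Q[of 0] e by (intro exI[of _ 0] exI[of _ 1])
          (auto simp: good_def N0 quadratic_seminorm.nonneg quadratic_norm_def intro: order.trans[of _ 0])
    next
      case False
      then have Nw: "0 < N w" using N_eq_0[of w] N_nonneg[of w] by simp
      define u where "u = complex_of_real (1 / N w) *s w"
      have w: "w = complex_of_real (N w) *s u" using Nw by (simp add: u_def)
      have Nu: "N u = 1" using Nw by (simp add: u_def N_scale norm_divide)
      define h where "h = e / (3 * N w)"
      have h: "0 < h" using e Nw by (simp add: h_def)
      obtain j :: nat where j: "1 / h < real j" using reals_Archimedean2 by blast
      have dj: "d j \<le> h" using j h by (simp add: d_def divide_simps) (simp add: algebra_simps)
      have "u \<in> closure T" using T(3) Nu by auto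
      moreover have "0 < h / (C + 1)" using h C(1) by simp
      ultimately obtain y where "y \<in> T" "dist y u < h / (C + 1)"
        unfolding closure_approachable by blast
      then obtain i where i: "dist (a i) u < h / (C + 1)" using range_a by auto
      have diff: "N (u - a i) \<le> h"
      proof -
        have "N (u - a i) \<le> C * norm (u - a i)" by (rule C(2))
        also have "\<dots> \<le> (C + 1) * (h / (C + 1))"
          using i C(1) by (intro mult_mono) (auto simp: dist_norm norm_minus_commute)
        finally show ?thesis using C(1) by simp
      qed
      define m where "m = prod_encode (i, j)"
      have g: "good i j (Q m)" using Q[of m] by (simp add: m_def)
      interpret Qm: quadratic_norm "Q m" using g by (simp add: good_def)
      have Q1: "Q m 1 \<le> 1" and contr: "\<And>w v. sqrt (Q m (w * v)) \<le> N w * sqrt (Q m v)"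
        and lower: "(1 - d j) * (N (a i))\<^sup>2 \<le> Q m (a i)"
        using g by (simp_all add: good_def)
      have "sqrt (Q m (u - a i)) \<le> N (u - a i) * sqrt (Q m 1)" using contr[of "u - a i" 1] by simp
      also have "\<dots> \<le> h * 1" using diff Q1 h by (intro mult_mono) (auto simp: Qm.nonneg)
      finally have 1: "sqrt (Q m (u - a i)) \<le> h" by simp
      have Nai: "1 - h \<le> N (a i)" using N_triangle[of "u - a i" "a i"] diff Nu by simp
      have 2: "(1 - d j) * N (a i) \<le> sqrt (Q m (a i))"
      proof (rule real_le_rsqrt)
        have "((1 - d j) * N (a i))\<^sup>2 = (1 - d j) * ((1 - d j) * (N (a i))\<^sup>2)"
          by (simp add: power2_eq_square)
        also have "\<dots> \<le> 1 * ((1 - d j) * (N (a i))\<^sup>2)"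
          using d[of j] by (intro mult_right_mono) auto
        finally show "((1 - d j) * N (a i))\<^sup>2 \<le> Q m (a i)" using lower by simp
      qed
      have "d j * N (a i) \<le> d j * 1" using a_ball[of i] d[of j] by (intro mult_left_mono) auto
      then have "1 - 2 * h \<le> sqrt (Q m (a i))" using 2 Nai dj by (simp add: algebra_simps)
      moreover have "sqrt (Q m (a i)) \<le> sqrt (Q m u) + h"
        using Qm.sqrt_diff_le[of u "a i"] 1 by linarith
      ultimately have "1 - 3 * h \<le> sqrt (Q m u)" by simp
      then have "N w * (1 - 3 * h) \<le> N w * sqrt (Q m u)" using Nw by simp
      moreover have "N w * (1 - 3 * h) = N w - e" using Nw by (simp add: h_def field_simps)
      moreover have "sqrt (Q m w) = N w * sqrt (Q m u)"
        by (subst w) (use Nw in \<open>simp add: Qm.sqrt_scale\<close>)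
      ultimately show ?thesis using Q1 by (intro exI[of _ m] exI[of _ 1]) simp
    qed
  qed
qed

section \<open>The operator norm of a single quadratic norm\<close>

context quadratic_norm
begin

definition mult_norm :: "complex ^ 'k \<Rightarrow> real" where
  "mult_norm w = (SUP v\<in>{v. Q v \<le> 1}. sqrt (Q (w * v)))"

lemma bdd_above_mult: "bdd_above ((\<lambda>v. sqrt (Q (w * v))) ` {v. Q v \<le> 1})"
proof -
  have "sqrt (Q (w * (c *s v))) = cmod c * sqrt (Q (w * v))" for c v
    by (simp add: mult_vec_scale sqrt_scale)
  moreover have "sqrt (Q (w * (u + v))) \<le> sqrt (Q (w * u)) + sqrt (Q (w * v))" for u v
    by (simp add: distrib_left sqrt_triangle)
  ultimately obtain C where C: "0 \<le> C" "\<And>v. sqrt (Q (w * v)) \<le> C * norm v"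
    using seminorm_le_euclidean[of "\<lambda>v. sqrt (Q (w * v))"] by blast
  obtain r where r: "0 < r" "\<And>v. r * norm v \<le> sqrt (Q v)" using definite by blast
  show ?thesis
  proof (rule bdd_aboveI2)
    fix v assume "v \<in> {v. Q v \<le> 1}"
    then have "sqrt (Q v) \<le> 1" by simp
    with r(2)[of v] have "r * norm v \<le> 1" by linarith
    then have "norm v * r \<le> 1" by (simp only: mult.commute)
    then have "norm v \<le> 1 / r" using r(1) by (simp add: pos_le_divide_eq)
    then have "C * norm v \<le> C * (1 / r)" using C(1) by (rule mult_left_mono)
    with C(2)[of v] show "sqrt (Q (w * v)) \<le> C * (1 / r)" by simp
  qed
qed

lemma mult_norm_nonneg: "0 \<le> mult_norm w"
  using cSUP_upper[OF _ bdd_above_mult, of 0 w] by (simp add: mult_norm_def)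

lemma mult_le: "sqrt (Q (w * v)) \<le> mult_norm w * sqrt (Q v)"
proof (cases "v = 0")
  case False
  define r where "r = sqrt (Q v)"
  have r: "0 < r" using False nonneg[of v] by (simp add: r_def less_le eq_0_iff)
  let ?u = "complex_of_real (1 / r) *s v"
  have "sqrt (Q ?u) = 1" using r unfolding sqrt_scale by (simp add: norm_divide flip: r_def)
  then have "sqrt (Q (w * ?u)) \<le> mult_norm w"
    unfolding mult_norm_def by (intro cSUP_upper bdd_above_mult) simp
  then show ?thesis
    using r by (simp add: mult_vec_scale sqrt_scale norm_divide pos_divide_le_eq flip: r_def)
qed simp

lemma mult_norm_le:
  assumes "0 \<le> B" "\<And>v. sqrt (Q (w * v)) \<le> B * sqrt (Q v)"
  shows "mult_norm w \<le> B"
  unfolding mult_norm_def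
proof (rule cSUP_least)
  show "{v. Q v \<le> 1} \<noteq> {}" by (auto intro: exI[of _ 0])
  fix v assume "v \<in> {v. Q v \<le> 1}"
  then have "B * sqrt (Q v) \<le> B * 1" using assms(1) by (intro mult_left_mono) auto
  with assms(2)[of v] show "sqrt (Q (w * v)) \<le> B" by simp
qed

lemma banach_algebra_mult_norm: "banach_algebra_norm mult_norm"
  unfolding banach_algebra_norm_def
proof (intro conjI allI)
  fix v w c
  have Q1: "0 < sqrt (Q 1)" using nonneg[of 1] eq_0_iff[of 1] by (simp add: less_le)
  show "0 \<le> mult_norm v" by (rule mult_norm_nonneg)
  have zero: "mult_norm 0 = 0" using mult_norm_nonneg[of 0] mult_norm_le[of 0 0] by simp
  show "mult_norm v = 0 \<longleftrightarrow> v = 0"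
  proof
    assume "mult_norm v = 0"
    with mult_le[of v 1] nonneg[of v] have "Q v = 0" by simp
    then show "v = 0" by (simp add: eq_0_iff)
  qed (simp add: zero)
  have scale_le: "mult_norm (c *s v) \<le> cmod c * mult_norm v" for c v
    by (rule mult_norm_le)
      (simp_all add: mult_norm_nonneg vec_scale_mult sqrt_scale mult_le mult_left_mono mult.assoc)
  show "mult_norm (c *s v) = cmod c * mult_norm v"
  proof (cases "c = 0")
    case False
    have "mult_norm v \<le> cmod (inverse c) * mult_norm (c *s v)"
      using scale_le[of "inverse c" "c *s v"] False by simp
    then have "mult_norm v \<le> inverse (cmod c) * mult_norm (c *s v)" by (simp only: norm_inverse)
    then have "cmod c * mult_norm v \<le> cmod c * (inverse (cmod c) * mult_norm (c *s v))"
      by (rule mult_left_mono) simp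
    then have "cmod c * mult_norm v \<le> mult_norm (c *s v)" using False by (simp flip: mult.assoc)
    with scale_le[of c v] show ?thesis by simp
  qed (simp add: zero)
  show "mult_norm (v + w) \<le> mult_norm v + mult_norm w"
  proof (rule mult_norm_le)
    fix u
    have "sqrt (Q ((v + w) * u)) \<le> sqrt (Q (v * u)) + sqrt (Q (w * u))"
      by (simp add: distrib_right sqrt_triangle)
    also have "\<dots> \<le> (mult_norm v + mult_norm w) * sqrt (Q u)"
      using mult_le[of v u] mult_le[of w u] by (simp add: distrib_right)
    finally show "sqrt (Q ((v + w) * u)) \<le> (mult_norm v + mult_norm w) * sqrt (Q u)" .
  qed (simp add: mult_norm_nonneg)
  show "mult_norm (v * w) \<le> mult_norm v * mult_norm w"
  proof (rule mult_norm_le)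
    fix u
    have "sqrt (Q (v * w * u)) \<le> mult_norm v * sqrt (Q (w * u))"
      using mult_le[of v "w * u"] by (simp add: mult.assoc)
    also have "\<dots> \<le> mult_norm v * (mult_norm w * sqrt (Q u))"
      by (intro mult_left_mono mult_le mult_norm_nonneg)
    finally show "sqrt (Q (v * w * u)) \<le> mult_norm v * mult_norm w * sqrt (Q u)" by (simp add: mult.assoc)
  qed (simp add: mult_norm_nonneg)
  show "mult_norm 1 = 1"
  proof (rule antisym)
    show "mult_norm 1 \<le> 1" by (rule mult_norm_le) simp_all
    show "1 \<le> mult_norm 1" using mult_le[of 1 1] Q1 by simp
  qed
qed

lemma mult_norm_ball:
  assumes card: "(UNIV :: (nat \<Rightarrow> complex) set) \<lesssim> (UNIV :: 'h set)"
  shows "norm_ball mult_norm \<in> operator_algebra_balls TYPE('h)"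
proof (rule in_operator_algebra_balls[OF card banach_algebra_mult_norm, of "\<lambda>_. Q"])
  show "quadratic_norm Q" by unfold_locales
  show "\<exists>m v. Q v \<le> 1 \<and> mult_norm w - e \<le> sqrt (Q (w * v))" if "0 < e" for w and e :: real
  proof -
    have "mult_norm w - e < mult_norm w" using that by simp
    then have "\<exists>v\<in>{v. Q v \<le> 1}. mult_norm w - e < sqrt (Q (w * v))"
      unfolding mult_norm_def[of w] by (subst (asm) less_cSUP_iff) (auto intro!: bdd_above_mult exI[of _ 0])
    then show ?thesis by (auto intro: less_imp_le)
  qed
qed (rule mult_le)

end

lemma norm_ball_inj:
  assumes N: "banach_algebra_norm N" "banach_algebra_norm M" and eq: "norm_ball N = norm_ball M"
  shows "N = M"
proof -
  have le: "M v \<le> N v"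
    if N: "banach_algebra_norm N" "banach_algebra_norm M" and eq: "norm_ball N = norm_ball M"
    for N M :: "complex ^ 'k \<Rightarrow> real" and v
  proof (cases "v = 0")
    case True
    have "M 0 = 0" "N 0 = 0" using N by (simp_all add: banach_algebra_norm_def)
    then show ?thesis using True by simp
  next
    case False
    then have "N v \<noteq> 0" "0 \<le> N v" using N by (simp_all add: banach_algebra_norm_def)
    then have pos: "0 < N v" by simp
    then have "N (complex_of_real (1 / N v) *s v) \<le> 1"
      using N(1) by (simp add: banach_algebra_norm_def norm_divide)
    then have "M (complex_of_real (1 / N v) *s v) \<le> 1" using eq by (auto simp: norm_ball_def)
    then show ?thesis using N(2) pos by (simp add: banach_algebra_norm_def norm_divide field_simps)
  qed
  show ?thesis using le[OF N eq] le[OF N(2,1) eq[symmetric]] by (intro ext antisym)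
qed

section \<open>A polynomial on the tridisc\<close>

text \<open>
  The polynomial of Kaijser and Varopoulos,
  \<open>x\<^sup>2 + y\<^sup>2 + z\<^sup>2 - 2xy - 2yz - 2zx\<close>, over any commutative ring so that it can be
  evaluated on numbers and on vectors alike.
\<close>
definition varopoulos :: "'a::comm_ring_1 \<Rightarrow> 'a \<Rightarrow> 'a \<Rightarrow> 'a" where
  "varopoulos x y z = 2 * (x * x + y * y + z * z) - (x + y + z) * (x + y + z)"

text \<open>
  As a quadratic in \<open>x\<close> this has discriminant \<open>c\<^sup>2 (16 c\<^sup>2 - 15)\<close>, so it is nonnegative if
  \<open>c\<^sup>2 \<le> 15/16\<close>. Otherwise it increases on the interval from \<open>-1\<close> to \<open>1\<close>, and its value at \<open>-1\<close> has the factor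
  \<open>1 - c\<close>.
\<close>
lemma real_polynomial_nonneg:
  fixes c x :: real
  assumes c: "0 \<le> c" "c \<le> 1" and x: "\<bar>x\<bar> \<le> 1"
  shows "0 \<le> 2 * (1 - c\<^sup>2) * x\<^sup>2 + c * (4 * c\<^sup>2 - 3) * x + c\<^sup>2 * (3 - 2 * c\<^sup>2)"
proof (cases "16 * c\<^sup>2 \<le> 15")
  case True
  define A B where "A = 2 * (1 - c\<^sup>2)" and "B = c * (4 * c\<^sup>2 - 3)"
  have A: "0 < A" using True by (simp add: A_def)
  have "0 \<le> (2 * A * x + B)\<^sup>2 + c\<^sup>2 * (15 - 16 * c\<^sup>2)" using True by simp
  also have "\<dots> = 4 * A * (A * x\<^sup>2 + B * x + c\<^sup>2 * (3 - 2 * c\<^sup>2))"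
    by (simp add: A_def B_def power2_eq_square algebra_simps)
  finally show ?thesis using A by (simp add: zero_le_mult_iff A_def B_def)
next
  case False
  have c2: "15 / 16 < c\<^sup>2" "c\<^sup>2 \<le> 1" using False c by (simp_all add: power_le_one)
  have "c\<^sup>2 \<le> c" using c by (simp add: power2_eq_square mult_left_le)
  then have c': "15 / 16 < c" using c2 by simp
  have eq: "2 * (1 - c\<^sup>2) * x\<^sup>2 + c * (4 * c\<^sup>2 - 3) * x + c\<^sup>2 * (3 - 2 * c\<^sup>2)
    = (x + 1) * (2 * (1 - c\<^sup>2) * (x - 1) + c * (4 * c\<^sup>2 - 3)) + (1 - c) * (2 * c ^ 3 + 6 * c\<^sup>2 + 5 * c + 2)"
    by (simp add: power2_eq_square power3_eq_cube algebra_simps)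
  have "(15 / 16) * (3 / 4) \<le> c * (4 * c\<^sup>2 - 3)"
    using c' c2 by (intro mult_mono) auto
  moreover have "2 * (1 - c\<^sup>2) * (x - 1) \<ge> 2 * (1 - c\<^sup>2) * (- 2)"
    using x c2 by (intro mult_left_mono) auto
  ultimately have "0 \<le> 2 * (1 - c\<^sup>2) * (x - 1) + c * (4 * c\<^sup>2 - 3)" using c2 by (simp add: algebra_simps)
  then have "0 \<le> (x + 1) * (2 * (1 - c\<^sup>2) * (x - 1) + c * (4 * c\<^sup>2 - 3))"
    using x by (intro mult_nonneg_nonneg) auto
  moreover have "0 \<le> (1 - c) * (2 * c ^ 3 + 6 * c\<^sup>2 + 5 * c + 2)" using c by simp
  ultimately show ?thesis unfolding eq by (rule add_nonneg_nonneg)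
qed

text \<open>
  With \<open>c = Re w\<close> and \<open>x = Re z\<close> the difference \<open>25 - \<bar>varopoulos z w (cnj w)\<bar>\<^sup>2\<close> is \<open>8\<close> times the
  real polynomial above. Replacing \<open>(c, x)\<close> by \<open>(- c, - x)\<close> does not change it.
\<close>
lemma cmod_varopoulos_symmetric_le:
  assumes "cmod z = 1" "cmod w = 1"
  shows "cmod (varopoulos z w (cnj w)) \<le> 5"
proof -
  have nonneg: "0 \<le> 2 * (1 - c\<^sup>2) * x\<^sup>2 + c * (4 * c\<^sup>2 - 3) * x + c\<^sup>2 * (3 - 2 * c\<^sup>2)"
    if "\<bar>c\<bar> \<le> 1" "\<bar>x\<bar> \<le> 1" for c x :: real
  proof (cases "0 \<le> c")
    case False
    then show ?thesis using real_polynomial_nonneg[of "- c" "- x"] that by simp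
  qed (use real_polynomial_nonneg that in auto)
  define c s x y where "c = Re w" and "s = Im w" and "x = Re z" and "y = Im z"
  have s: "s\<^sup>2 = 1 - c\<^sup>2" and y: "y\<^sup>2 = 1 - x\<^sup>2"
    using assms by (simp_all add: c_def s_def x_def y_def cmod_def)
  have cx: "\<bar>c\<bar> \<le> 1" "\<bar>x\<bar> \<le> 1"
    using assms abs_Re_le_cmod[of w] abs_Re_le_cmod[of z] by (simp_all add: c_def x_def)
  have w: "w = Complex c s" and z: "z = Complex x y" by (simp_all add: c_def s_def x_def y_def)
  have "Re (varopoulos z w (cnj w)) = (x\<^sup>2 - y\<^sup>2) - 4 * c * x - 4 * s\<^sup>2"
    by (simp add: varopoulos_def w z power2_eq_square algebra_simps)
  also have "\<dots> = 2 * x\<^sup>2 - 4 * c * x + 4 * c\<^sup>2 - 5" using s y by simp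
  finally have re: "Re (varopoulos z w (cnj w)) = 2 * x\<^sup>2 - 4 * c * x + 4 * c\<^sup>2 - 5" .
  have im: "Im (varopoulos z w (cnj w)) = y * (2 * x - 4 * c)"
    by (simp add: varopoulos_def w z algebra_simps)
  have "(cmod (varopoulos z w (cnj w)))\<^sup>2 = (2 * x\<^sup>2 - 4 * c * x + 4 * c\<^sup>2 - 5)\<^sup>2 + (1 - x\<^sup>2) * (2 * x - 4 * c)\<^sup>2"
    by (simp add: cmod_power2 re im power_mult_distrib y)
  also have "\<dots> = 25 - 8 * (2 * (1 - c\<^sup>2) * x\<^sup>2 + c * (4 * c\<^sup>2 - 3) * x + c\<^sup>2 * (3 - 2 * c\<^sup>2))"
    by (simp add: power2_eq_square algebra_simps)
  also have "\<dots> \<le> 5\<^sup>2" using nonneg[OF cx] by simp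
  finally show ?thesis by (rule power2_le_imp_le) simp
qed

text \<open>
  The polynomial is homogeneous, and dividing all arguments by a square root of \<open>y z\<close> makes the last two
  conjugate.
\<close>
lemma cmod_varopoulos_torus_le:
  assumes "cmod x = 1" "cmod y = 1" "cmod z = 1"
  shows "cmod (varopoulos x y z) \<le> 5"
proof -
  define m where "m = csqrt (y * z)"
  have mm: "m * m = y * z" by (simp add: m_def flip: power2_eq_square)
  have m: "cmod m = 1" by (simp add: m_def norm_csqrt norm_mult assms)
  have "m \<noteq> 0" using m by auto
  have cnj_m: "cnj m = 1 / m" "cnj y = 1 / y"
    using complex_div_cnj[of 1 m] complex_div_cnj[of 1 y] m assms by auto
  have "cmod (x / m) = 1" "cmod (y / m) = 1" using m assms by (simp_all add: norm_divide)
  then have le: "cmod (varopoulos (x / m) (y / m) (cnj (y / m))) \<le> 5" by (rule cmod_varopoulos_symmetric_le)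
  have "y \<noteq> 0" using assms by auto
  have "cnj (y / m) = m / y" using \<open>y \<noteq> 0\<close> \<open>m \<noteq> 0\<close> by (simp add: cnj_m)
  also have "m / y = z / m" using mm \<open>y \<noteq> 0\<close> \<open>m \<noteq> 0\<close> by (simp add: field_simps)
  finally have z: "cnj (y / m) = z / m" .
  have "varopoulos x y z = m * m * varopoulos (x / m) (y / m) (z / m)"
    using \<open>m \<noteq> 0\<close> by (simp add: varopoulos_def field_simps)
  then show ?thesis using le[unfolded z] m by (simp add: norm_mult)
qed

lemma maximum_modulus_disc:
  assumes "f holomorphic_on UNIV" "\<And>z. cmod z = 1 \<Longrightarrow> cmod (f z) \<le> B" "cmod z \<le> 1"
  shows "cmod (f z) \<le> B"
proof (rule maximum_modulus_frontier[of f "cball 0 1"])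
  show "f holomorphic_on interior (cball 0 1)" using assms(1) by (rule holomorphic_on_subset) simp
  show "continuous_on (closure (cball 0 1)) f"
    using assms(1) by (intro holomorphic_on_imp_continuous_on) (rule holomorphic_on_subset, auto)
qed (use assms in auto)

lemma cmod_varopoulos_le:
  assumes "cmod x \<le> 1" "cmod y \<le> 1" "cmod z \<le> 1"
  shows "cmod (varopoulos x y z) \<le> 5"
proof (rule maximum_modulus_disc[of "\<lambda>x. varopoulos x y z"])
  fix x :: complex assume x: "cmod x = 1"
  show "cmod (varopoulos x y z) \<le> 5"
  proof (rule maximum_modulus_disc[of "\<lambda>y. varopoulos x y z"])
    fix y :: complex assume y: "cmod y = 1"
    show "cmod (varopoulos x y z) \<le> 5"
      by (rule maximum_modulus_disc[of "\<lambda>z. varopoulos x y z"])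
        (use cmod_varopoulos_torus_le x y assms in \<open>auto simp: varopoulos_def intro!: holomorphic_intros\<close>)
  qed (use assms in \<open>auto simp: varopoulos_def intro!: holomorphic_intros\<close>)
qed (use assms in \<open>auto simp: varopoulos_def intro!: holomorphic_intros\<close>)

lemma in_variables_const: "in_variables n (const c)"
  by (auto simp: in_variables_def const_def)

lemma in_variables_var: "i < n \<Longrightarrow> in_variables n (var i)"
  by (auto simp: in_variables_def var_def)

lemma in_variables_add: "in_variables n p \<Longrightarrow> in_variables n q \<Longrightarrow> in_variables n (p + q)"
  unfolding in_variables_def using Poly_Mapping.keys_add[of p q] by (meson Un_iff subsetD)

lemma in_variables_diff: "in_variables n p \<Longrightarrow> in_variables n q \<Longrightarrow> in_variables n (p - q)"
  unfolding in_variables_def using Poly_Mapping.keys_diff[of p q] by (meson Un_iff subsetD)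

lemma in_variables_mult: "in_variables n p \<Longrightarrow> in_variables n q \<Longrightarrow> in_variables n (p * q)"
  unfolding in_variables_def
proof
  fix m assume p: "\<forall>m\<in>Poly_Mapping.keys p. Poly_Mapping.keys m \<subseteq> {..<n}"
    and q: "\<forall>m\<in>Poly_Mapping.keys q. Poly_Mapping.keys m \<subseteq> {..<n}"
    and "m \<in> Poly_Mapping.keys (p * q)"
  then obtain k l where kl: "m = k + l" "k \<in> Poly_Mapping.keys p" "l \<in> Poly_Mapping.keys q"
    using subsetD[OF Poly_Mapping.keys_mult[of p q]] by blast
  have "Poly_Mapping.keys m \<subseteq> Poly_Mapping.keys k \<union> Poly_Mapping.keys l"
    unfolding kl(1) by (rule Poly_Mapping.keys_add)
  also have "\<dots> \<subseteq> {..<n}" using bspec[OF p kl(2)] bspec[OF q kl(3)] by (rule Un_least)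
  finally show "Poly_Mapping.keys m \<subseteq> {..<n}" .
qed

definition varopoulos_cpoly :: cpoly where
  "varopoulos_cpoly = const 2 * (var 0 * var 0 + var 1 * var 1 + var 2 * var 2)
    - (var 0 + var 1 + var 2) * (var 0 + var 1 + var 2)"

lemma in_variables_varopoulos_cpoly: "in_variables 3 varopoulos_cpoly"
  unfolding varopoulos_cpoly_def
  by (intro in_variables_diff in_variables_mult in_variables_add in_variables_const in_variables_var) auto

lemma polydisc_sup_varopoulos_cpoly: "polydisc_sup 3 varopoulos_cpoly \<le> 5"
  unfolding polydisc_sup_def
proof (rule cSUP_least)
  show "{z. \<forall>i<3. cmod (z i) \<le> 1} \<noteq> {}" by (auto intro: exI[of _ "\<lambda>_. 0"])
  fix z :: "nat \<Rightarrow> complex" assume z: "z \<in> {z. \<forall>i<3. cmod (z i) \<le> 1}"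
  have "eval_poly id z varopoulos_cpoly = varopoulos (z 0) (z 1) (z 2)"
    by (simp only: varopoulos_cpoly_def varopoulos_def eval_id id_apply)
  then show "cmod (eval_poly id z varopoulos_cpoly) \<le> 5" using z by (simp add: cmod_varopoulos_le)
qed

section \<open>An operator algebra norm violating the von Neumann inequality\<close>

locale four_points =
  fixes p q r s :: "'k::finite"
  assumes distinct: "distinct [p, q, r, s]"
begin

lemma neq: "p \<noteq> q" "p \<noteq> r" "p \<noteq> s" "q \<noteq> r" "q \<noteq> s" "r \<noteq> s"
  "q \<noteq> p" "r \<noteq> p" "s \<noteq> p" "r \<noteq> q" "s \<noteq> q" "s \<noteq> r"
  using distinct by auto

definition c0 :: "complex ^ 'k \<Rightarrow> complex" where "c0 v = (v $ p + v $ q + v $ r + v $ s) / 4"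
definition c1 :: "complex ^ 'k \<Rightarrow> complex" where "c1 v = (v $ p + v $ q - v $ r - v $ s) / 4"
definition c2 :: "complex ^ 'k \<Rightarrow> complex" where "c2 v = (v $ p - v $ q + v $ r - v $ s) / 4"
definition c3 :: "complex ^ 'k \<Rightarrow> complex" where "c3 v = (v $ p - v $ q - v $ r + v $ s) / 4"

definition rest :: "complex ^ 'k \<Rightarrow> real" where
  "rest v = (\<Sum>x\<in>- {p, q, r, s}. (cmod (v $ x))\<^sup>2)"

text \<open>
  The functions \<open>1, \<sigma>, \<tau>, \<sigma>\<tau>\<close> on the four points \<open>p, q, r, s\<close> have the coordinates \<open>c0, c1, c2, c3\<close>; the
  signs \<open>(\<sigma>, \<tau>)\<close> at these points are \<open>(1, 1), (1, -1), (-1, 1), (-1, -1)\<close>. Normalising the four functions in this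
  form turns multiplication by \<open>\<sigma>/3\<close> and \<open>\<tau>/3\<close> into \<open>S \<otimes> 1\<close> and \<open>1 \<otimes> S\<close> on
  \<open>\<complex>\<^sup>2 \<otimes> \<complex>\<^sup>2\<close>, where \<open>S\<close> has entries \<open>1\<close> and \<open>1/9\<close> off the diagonal. This
  perturbs the nilpotent shift, for which the polynomial takes the norm \<open>6\<close>, to a diagonalisable
  matrix.
\<close>
definition form :: "complex ^ 'k \<Rightarrow> real" where
  "form v = (cmod (c0 v))\<^sup>2 + 9 * (cmod (c1 v))\<^sup>2 + 9 * (cmod (c2 v))\<^sup>2 + 81 * (cmod (c3 v))\<^sup>2 + rest v"

definition quad :: "complex \<Rightarrow> complex \<Rightarrow> complex \<Rightarrow> complex \<Rightarrow> complex ^ 'k" where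
  "quad a b c d = (\<chi> x. if x = p then a else if x = q then b else if x = r then c else if x = s then d else 0)"

lemma quad_simps [simp]: "quad a b c d $ p = a" "quad a b c d $ q = b" "quad a b c d $ r = c" "quad a b c d $ s = d"
  "x \<notin> {p, q, r, s} \<Longrightarrow> quad a b c d $ x = 0"
  by (simp_all add: quad_def neq)

lemma quad_eqI:
  assumes "v $ p = a" "v $ q = b" "v $ r = c" "v $ s = d" "\<And>x. x \<notin> {p, q, r, s} \<Longrightarrow> v $ x = 0"
  shows "v = quad a b c d"
  using assms by (auto simp: vec_eq_iff quad_def)

lemma quadratic_seminorm_form: "quadratic_seminorm form"
  unfolding form_def rest_def c0_def c1_def c2_def c3_def
  by (intro quadratic_seminorm_add quadratic_seminorm_mult quadratic_seminorm_sum quadratic_seminorm_linear)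
    (simp_all add: field_simps)

lemma rest_nonneg: "0 \<le> rest v"
  by (simp add: rest_def sum_nonneg)

lemma form_definite: "\<exists>t>0. \<forall>v. t * norm v \<le> sqrt (form v)"
proof (intro exI[of _ "1/2"] conjI allI)
  fix v
  have four: "(cmod ((a + b + c + d) / 4))\<^sup>2 + (cmod ((a + b - c - d) / 4))\<^sup>2 + (cmod ((a - b + c - d) / 4))\<^sup>2
      + (cmod ((a - b - c + d) / 4))\<^sup>2 = ((cmod a)\<^sup>2 + (cmod b)\<^sup>2 + (cmod c)\<^sup>2 + (cmod d)\<^sup>2) / 4" for a b c d
    unfolding cmod_power2 by (simp add: power2_eq_square field_simps)
  have split: "(\<Sum>x\<in>UNIV. (cmod (v $ x))\<^sup>2) = (\<Sum>x\<in>{p, q, r, s}. (cmod (v $ x))\<^sup>2) + rest v"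
    unfolding rest_def by (subst sum.union_disjoint[symmetric]) auto
  have "(\<Sum>x\<in>{p, q, r, s}. (cmod (v $ x))\<^sup>2)
      = 4 * ((cmod (c0 v))\<^sup>2 + (cmod (c1 v))\<^sup>2 + (cmod (c2 v))\<^sup>2 + (cmod (c3 v))\<^sup>2)"
    unfolding c0_def c1_def c2_def c3_def using four[of "v $ p" "v $ q" "v $ r" "v $ s"]
    by (simp add: neq)
  then have "(norm v)\<^sup>2 \<le> 4 * form v"
    using rest_nonneg[of v] by (simp add: norm_vec_def L2_set_def sum_nonneg split form_def)
  then have "(1 / 2 * norm v)\<^sup>2 \<le> form v" by (simp add: power_mult_distrib power_divide)
  then show "1 / 2 * norm v \<le> sqrt (form v)" by (rule real_le_rsqrt)
qed simp

sublocale quadratic_norm form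
  by (intro quadratic_norm.intro quadratic_seminorm_form quadratic_norm_axioms.intro form_definite)

definition \<kappa> :: real where "\<kappa> = sqrt (1 / 20)"

definition gen :: "complex \<Rightarrow> complex ^ 'k" where
  "gen u = quad (\<kappa> * (cnj u + u)) (\<kappa> * (cnj u - u)) (\<kappa> * (u - cnj u)) (- (\<kappa> * (cnj u + u)))"

lemma gen_coefficients:
  "c0 (gen u * v) = \<kappa> * (cnj u * c1 v + u * c2 v)" "c1 (gen u * v) = \<kappa> * (cnj u * c0 v + u * c3 v)"
  "c2 (gen u * v) = \<kappa> * (u * c0 v + cnj u * c3 v)" "c3 (gen u * v) = \<kappa> * (cnj u * c2 v + u * c1 v)"
  "rest (gen u * v) = 0"
  by (simp_all add: c0_def c1_def c2_def c3_def gen_def rest_def field_simps)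

text \<open>
  The weights leave room for \<open>\<kappa>\<^sup>2 = 1/20\<close>: the inequality \<open>\<bar>x + y\<bar>\<^sup>2 \<le> 10/9 \<bar>x\<bar>\<^sup>2 + 10 \<bar>y\<bar>\<^sup>2\<close> bounds the
  coefficient of \<open>\<bar>c0 v\<bar>\<^sup>2\<close> by exactly \<open>1\<close>, and the others are strictly smaller than the weights in \<open>form\<close>.
\<close>
lemma form_gen_le:
  assumes u: "cmod u = 1"
  shows "form (gen u * v) \<le> form v"
proof -
  have two: "(cmod (x + y))\<^sup>2 \<le> 2 * (cmod x)\<^sup>2 + 2 * (cmod y)\<^sup>2" for x y
  proof -
    have "(cmod (x + y))\<^sup>2 \<le> (cmod x + cmod y)\<^sup>2" by (intro power_mono norm_triangle_ineq) simp
    also have "\<dots> \<le> 2 * (cmod x)\<^sup>2 + 2 * (cmod y)\<^sup>2"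
      using zero_le_power2[of "cmod x - cmod y"] by (simp add: power2_diff power2_sum)
    finally show ?thesis .
  qed
  have ten: "(cmod (x + y))\<^sup>2 \<le> 10 / 9 * (cmod x)\<^sup>2 + 10 * (cmod y)\<^sup>2" for x y
  proof -
    have "(cmod (x + y))\<^sup>2 \<le> (cmod x + cmod y)\<^sup>2" by (intro power_mono norm_triangle_ineq) simp
    also have "\<dots> \<le> 10 / 9 * (cmod x)\<^sup>2 + 10 * (cmod y)\<^sup>2"
      using zero_le_power2[of "cmod x / 3 - 3 * cmod y"] by (simp add: power2_diff power2_sum power_divide power_mult_distrib)
    finally show ?thesis .
  qed
  have k: "(cmod (complex_of_real \<kappa> * x))\<^sup>2 = (cmod x)\<^sup>2 / 20" for x
    by (simp add: norm_mult power_mult_distrib \<kappa>_def)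
  have eq: "form (gen u * v) = ((cmod (cnj u * c1 v + u * c2 v))\<^sup>2 + 9 * (cmod (cnj u * c0 v + u * c3 v))\<^sup>2
      + 9 * (cmod (u * c0 v + cnj u * c3 v))\<^sup>2 + 81 * (cmod (cnj u * c2 v + u * c1 v))\<^sup>2) / 20"
    unfolding form_def gen_coefficients k by (simp add: field_simps)
  have outer: "(cmod (cnj u * c1 v + u * c2 v))\<^sup>2 \<le> 2 * (cmod (c1 v))\<^sup>2 + 2 * (cmod (c2 v))\<^sup>2"
    "(cmod (cnj u * c2 v + u * c1 v))\<^sup>2 \<le> 2 * (cmod (c2 v))\<^sup>2 + 2 * (cmod (c1 v))\<^sup>2"
    using two[of "cnj u * c1 v" "u * c2 v"] two[of "cnj u * c2 v" "u * c1 v"] by (simp_all add: norm_mult u)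
  have inner: "(cmod (cnj u * c0 v + u * c3 v))\<^sup>2 \<le> 10 / 9 * (cmod (c0 v))\<^sup>2 + 10 * (cmod (c3 v))\<^sup>2"
    "(cmod (u * c0 v + cnj u * c3 v))\<^sup>2 \<le> 10 / 9 * (cmod (c0 v))\<^sup>2 + 10 * (cmod (c3 v))\<^sup>2"
    using ten[of "cnj u * c0 v" "u * c3 v"] ten[of "u * c0 v" "cnj u * c3 v"] by (simp_all add: norm_mult u)
  have arith: "(A + 9 * B + 9 * C + 81 * D) / 20 \<le> x0 + 9 * x1 + 9 * x2 + 81 * x3 + t"
    if "A \<le> 2 * x1 + 2 * x2" "D \<le> 2 * x2 + 2 * x1" "B \<le> 10 / 9 * x0 + 10 * x3"
      "C \<le> 10 / 9 * x0 + 10 * x3" "0 \<le> x1" "0 \<le> x2" "0 \<le> x3" "0 \<le> t" for A B C D x0 x1 x2 x3 t :: real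
    using that by (simp add: field_simps)
  show ?thesis
    unfolding eq form_def[of v] by (rule arith[OF outer inner]) (simp_all add: rest_nonneg)
qed

definition \<omega> :: complex where "\<omega> = Complex (- 1 / 2) (sqrt 3 / 2)"

definition gens :: "nat \<Rightarrow> complex ^ 'k" where
  "gens i = (if i = 0 then gen 1 else if i = 1 then gen \<omega> else gen (cnj \<omega>))"

lemma mult_norm_gens_le: "mult_norm (gens i) \<le> 1"
proof -
  have "cmod \<omega> = 1" by (simp add: \<omega>_def cmod_def power_divide)
  then have "form (gens i * v) \<le> form v" for v by (simp add: gens_def form_gen_le)
  then show ?thesis by (intro mult_norm_le) simp_all
qed

text \<open>
  The three generators add up to \<open>0\<close>, and their squares to \<open>3/10 \<sigma>\<tau>\<close>, because \<open>1 + \<omega> + \<omega>\<^sup>2 = 0\<close>.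
\<close>
lemma varopoulos_cpoly_gens: "eval_poly vec gens varopoulos_cpoly = quad (3/5) (- 3/5) (- 3/5) (3/5)"
proof -
  define k d where "k = complex_of_real \<kappa>" and "d = \<i> * complex_of_real (sqrt 3)"
  have k: "k * k = 1 / 20" unfolding k_def of_real_mult[symmetric] \<kappa>_def by simp
  have d: "d * d = - 3"
    unfolding d_def by (simp add: complex_eq_iff)
  have \<omega>: "\<omega> + cnj \<omega> = - 1" "\<omega> - cnj \<omega> = d"
    by (simp_all add: \<omega>_def d_def complex_eq_iff)
  then have \<omega>': "cnj \<omega> + \<omega> = - 1" "cnj \<omega> - \<omega> = - d" by (simp_all add: algebra_simps)
  have gens: "gens 0 = quad (2 * k) 0 0 (- (2 * k))" "gens 1 = quad (- k) (- (k * d)) (k * d) k"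
    "gens 2 = quad (- k) (k * d) (- (k * d)) k"
    by (simp_all add: gens_def gen_def \<omega> \<omega>' k_def mult.commute[of 2])
  have "eval_poly vec gens varopoulos_cpoly = varopoulos (gens 0) (gens 1) (gens 2)"
    by (simp only: varopoulos_cpoly_def varopoulos_def eval_vec) (simp add: vec_eq_iff)
  also have "\<dots> = quad (3/5) (- 3/5) (- 3/5) (3/5)"
  proof (rule quad_eqI)
    have comp: "varopoulos x y z $ i = varopoulos (x $ i) (y $ i) (z $ i)" for x y z :: "complex ^ 'k" and i
      by (simp add: varopoulos_def)
    have "varopoulos (2 * k) (- k) (- k) = 12 * (k * k)" "varopoulos (- (2 * k)) k k = 12 * (k * k)"
      "varopoulos 0 (- (k * d)) (k * d) = 4 * ((k * k) * (d * d))" "varopoulos 0 (k * d) (- (k * d)) = 4 * ((k * k) * (d * d))"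
      by (simp_all add: varopoulos_def algebra_simps)
    then show "varopoulos (gens 0) (gens 1) (gens 2) $ p = 3 / 5" "varopoulos (gens 0) (gens 1) (gens 2) $ q = - 3 / 5"
      "varopoulos (gens 0) (gens 1) (gens 2) $ r = - 3 / 5" "varopoulos (gens 0) (gens 1) (gens 2) $ s = 3 / 5"
      unfolding k d by (simp_all only: comp gens quad_simps) simp_all
    show "varopoulos (gens 0) (gens 1) (gens 2) $ x = 0" if "x \<notin> {p, q, r, s}" for x
      using that unfolding comp gens by (simp add: varopoulos_def)
  qed
  finally show ?thesis .
qed

text \<open>
  The norm of \<open>3/5 \<sigma>\<tau>\<close> is tested on the indicator function of the four points, whose form is \<open>1\<close>; the unit of
  \<open>\<complex>\<^sup>k\<close> would also count the other points.
\<close>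
lemma not_von_neumann: "\<not> von_neumann_inequality mult_norm"
proof
  assume vN: "von_neumann_inequality mult_norm"
  let ?f = "quad (3/5) (- 3/5) (- 3/5) (3/5)" and ?e = "quad 1 1 1 1"
  have "mult_norm (eval_poly vec gens varopoulos_cpoly) \<le> polydisc_sup 3 varopoulos_cpoly"
    using vN in_variables_varopoulos_cpoly mult_norm_gens_le
    unfolding von_neumann_inequality_def norm_ball_def by blast
  then have le: "mult_norm ?f \<le> 5" using polydisc_sup_varopoulos_cpoly by (simp add: varopoulos_cpoly_gens)
  have "form ?e = 1" by (simp add: form_def c0_def c1_def c2_def c3_def rest_def)
  moreover have "?f * ?e = ?f" by (rule quad_eqI) simp_all
  moreover have "form ?f = (27 / 5)\<^sup>2"
    by (simp add: form_def c0_def c1_def c2_def c3_def rest_def power2_eq_square)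
  ultimately have "27 / 5 \<le> mult_norm ?f" using mult_le[of ?f ?e] by simp
  with le show False by simp
qed

end

theorem mainTheorem2:
  assumes "CARD('k::finite) \<ge> 4"
    and "(UNIV :: (nat \<Rightarrow> complex) set) \<lesssim> (UNIV :: 'h set)"
  shows "(von_neumann_balls :: (complex ^ 'k) set set) \<subset> operator_algebra_balls TYPE('h)"
proof
  show "(von_neumann_balls :: (complex ^ 'k) set set) \<subseteq> operator_algebra_balls TYPE('h)"
    using von_neumann_ball_in_operator_algebra_balls[OF assms(2)] by (auto simp: von_neumann_balls_def)
  obtain f :: "nat \<Rightarrow> 'k" where f: "inj_on f {..<4}"
    using card_le_inj[of "{..<4::nat}" "UNIV :: 'k set"] assms(1) by auto
  interpret four_points "f 0" "f 1" "f 2" "f 3"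
    by unfold_locales (simp add: inj_on_eq_iff[OF f])
  have "norm_ball mult_norm \<notin> von_neumann_balls"
    using norm_ball_inj[OF banach_algebra_mult_norm] not_von_neumann
    by (auto simp: von_neumann_balls_def)
  then show "(von_neumann_balls :: (complex ^ 'k) set set) \<noteq> operator_algebra_balls TYPE('h)"
    using mult_norm_ball[OF assms(2)] by blast
qed

end
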